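(* Let $\Omega$ be a bounded domain in $\mathbb{R}^n$, let $f$ satisfy the standing assumptions, $p\geq1$, and $\nu\in\mathcal{P}(\Omega)$. Then there exists a unique $\mu\in\mathcal{P}(\Omega)$ minimizing $\mathfrak{F}^p_\nu$ over $\mathcal{P}(\Omega)$; it is absolutely continuous, $\mu=u\cdot\mathcal{L}^n$, and there exists a Kantorovich potential $\psi$ for the transport between $\mu$ and $\nu$ with cost $c(x,y)=|x-y|^p$ such that $-\psi\geq0$ a.e. and $u=k(-\psi)$ a.e. in $\Omega$, where $k=(f')^{-1}$.
   Context: A bounded domain is a bounded set $\Omega\subset\mathbb{R}^n$ which is the closure of a nonempty connected open set and whose boundary is Lebesgue-negligible. $\mathcal{P}(\Omega)$ is the set of Borel probability measures on $\Omega$. Standing assumptions on $f$: $f:[0,+\infty)\to[0,+\infty)$ is strictly convex and $C^1$, $f(0)=0$, $f'(0)=0$, and $\lim_{t\to+\infty}f(t)/t=+\infty$; $k=(f')^{-1}:[0,+\infty)\to[0,+\infty)$. $T_p(\mu,\nu)=\inf_\gamma\int|x-y|^p\,d\gamma$ over transport plans $\gamma$ (probability measures on $\Omega\times\Omega$ with marginals $\mu,\nu$). $F(\mu)=\int_\Omega f(u)\,dx$ if $\mu=u\cdot\mathcal{L}^n$, $+\infty$ otherwise. $\mathfrak{F}^p_\nu(\mu)=T_p(\mu,\nu)+F(\mu)$. For $c(x,y)=|x-y|^p$, $\chi^c(y)=\inf_{x\in\Omega}(c(x,y)-\chi(x))$; $\chi$ is $c$-concave if $\chi=\phi^c$ for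 some $\phi$. A Kantorovich potential between $\mu$ and $\nu$ is a $c$-concave $\psi$ maximizing $\int\varphi\,d\mu+\int\varphi^c\,d\nu$ among $c$-concave $\varphi$. *)

theory Defs
  imports "HOL-Analysis.Analysis" "HOL-Probability.Probability"
begin

definition strictly_convex_on :: "real set \<Rightarrow> (real \<Rightarrow> real) \<Rightarrow> bool" where
  "strictly_convex_on S f \<longleftrightarrow> convex S \<and>
     (\<forall>x\<in>S. \<forall>y\<in>S. x \<noteq> y \<longrightarrow> (\<forall>t::real. 0 < t \<and> t < 1 \<longrightarrow>
        f (t * x + (1 - t) * y) < t * f x + (1 - t) * f y))"

definition bounded_domain :: "'a::euclidean_space set \<Rightarrow> bool" where
  "bounded_domain \<Omega> \<longleftrightarrow> bounded \<Omega> \<and>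
     (\<exists>U. open U \<and> connected U \<and> U \<noteq> {} \<and> \<Omega> = closure U) \<and>
     frontier \<Omega> \<in> null_sets lborel"

definition standing_f :: "(real \<Rightarrow> real) \<Rightarrow> (real \<Rightarrow> real) \<Rightarrow> bool" where
  "standing_f f fd \<longleftrightarrow>
     (\<forall>t\<ge>0. f t \<ge> 0) \<and> strictly_convex_on {0..} f \<and>
     (\<forall>t\<ge>0. (f has_real_derivative fd t) (at t within {0..})) \<and>
     continuous_on {0..} fd \<and>
     f 0 = 0 \<and> fd 0 = 0 \<and> filterlim (\<lambda>t. f t / t) at_top at_top"

definition kinv :: "(real \<Rightarrow> real) \<Rightarrow> real \<Rightarrow> real" where
  "kinv fd = the_inv_into {0..} fd"

definition probs :: "'a::euclidean_space set \<Rightarrow> 'a measure set" where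
  "probs \<Omega> = {\<mu>. sets \<mu> = sets borel \<and> prob_space \<mu> \<and> emeasure \<mu> (UNIV - \<Omega>) = 0}"

definition plans :: "'a::euclidean_space measure \<Rightarrow> 'a measure \<Rightarrow> ('a \<times> 'a) measure set" where
  "plans \<mu> \<nu> = {\<gamma>. sets \<gamma> = sets (borel \<Otimes>\<^sub>M borel) \<and> prob_space \<gamma> \<and>
      distr \<gamma> borel fst = \<mu> \<and> distr \<gamma> borel snd = \<nu>}"

definition Tp :: "real \<Rightarrow> 'a::euclidean_space measure \<Rightarrow> 'a measure \<Rightarrow> ennreal" where
  "Tp p \<mu> \<nu> = (INF \<gamma>\<in>plans \<mu> \<nu>. \<integral>\<^sup>+ z. ennreal (dist (fst z) (snd z) powr p) \<partial>\<gamma>)"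

definition has_density :: "'a::euclidean_space measure \<Rightarrow> ('a \<Rightarrow> real) \<Rightarrow> bool" where
  "has_density \<mu> u \<longleftrightarrow> u \<in> borel_measurable borel \<and> (\<forall>x. 0 \<le> u x) \<and>
     \<mu> = density lborel (\<lambda>x. ennreal (u x))"

definition Fent :: "(real \<Rightarrow> real) \<Rightarrow> 'a::euclidean_space set \<Rightarrow> 'a measure \<Rightarrow> ennreal" where
  "Fent f \<Omega> \<mu> = (if \<exists>u. has_density \<mu> u
     then \<integral>\<^sup>+ x\<in>\<Omega>. ennreal (f ((SOME u. has_density \<mu> u) x)) \<partial>lborel
     else \<infinity>)"

definition frakF :: "real \<Rightarrow> (real \<Rightarrow> real) \<Rightarrow> 'a::euclidean_space set \<Rightarrow> 'a measure \<Rightarrow> 'a measure \<Rightarrow> ennreal" where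
  "frakF p f \<Omega> \<nu> \<mu> = Tp p \<mu> \<nu> + Fent f \<Omega> \<mu>"

definition c_transform :: "'a::euclidean_space set \<Rightarrow> real \<Rightarrow> ('a \<Rightarrow> real) \<Rightarrow> 'a \<Rightarrow> real" where
  "c_transform \<Omega> p g y = (INF x\<in>\<Omega>. dist x y powr p - g x)"

text \<open>c-concave (real-valued, on \<Omega>): g = \<phi>^c on \<Omega> for some \<phi> bounded above on \<Omega>
  (boundedness above only ensures the infimum is a genuine real infimum).\<close>
definition c_concave :: "'a::euclidean_space set \<Rightarrow> real \<Rightarrow> ('a \<Rightarrow> real) \<Rightarrow> bool" where
  "c_concave \<Omega> p g \<longleftrightarrow> (\<exists>\<phi>. bdd_above (\<phi> ` \<Omega>) \<and> (\<forall>y\<in>\<Omega>. g y = c_transform \<Omega> p \<phi> y))"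

definition kant_value :: "'a::euclidean_space set \<Rightarrow> real \<Rightarrow> 'a measure \<Rightarrow> 'a measure \<Rightarrow> ('a \<Rightarrow> real) \<Rightarrow> real" where
  "kant_value \<Omega> p \<mu> \<nu> \<phi> = (LINT x:\<Omega>|\<mu>. \<phi> x) + (LINT y:\<Omega>|\<nu>. c_transform \<Omega> p \<phi> y)"

definition kantorovich_potential :: "'a::euclidean_space set \<Rightarrow> real \<Rightarrow> 'a measure \<Rightarrow> 'a measure \<Rightarrow> ('a \<Rightarrow> real) \<Rightarrow> bool" where
  "kantorovich_potential \<Omega> p \<mu> \<nu> \<psi> \<longleftrightarrow> c_concave \<Omega> p \<psi> \<and>
     (\<forall>\<phi>. c_concave \<Omega> p \<phi> \<longrightarrow> kant_value \<Omega> p \<mu> \<nu> \<phi> \<le> kant_value \<Omega> p \<mu> \<nu> \<psi>)"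

definition is_minimizer :: "real \<Rightarrow> (real \<Rightarrow> real) \<Rightarrow> 'a::euclidean_space set \<Rightarrow> 'a measure \<Rightarrow> 'a measure \<Rightarrow> bool" where
  "is_minimizer p f \<Omega> \<nu> \<mu> \<longleftrightarrow> \<mu> \<in> probs \<Omega> \<and> (\<forall>\<mu>'\<in>probs \<Omega>. frakF p f \<Omega> \<nu> \<mu> \<le> frakF p f \<Omega> \<nu> \<mu>')"

end

theory Submission
  imports Defs "HOL-Complex_Analysis.Great_Picard"
begin

text \<open>The measure itself is never varied. Existence, uniqueness and the formula for
  \<open>u\<close> all come from one identity, \<open>energy_gap\<close>: for any density
  \<open>v\<close>, the dual transport value at \<psi> plus the internal energy equals
  \<open>J \<psi>\<close> plus the integral of the Young deficit
  \<open>f (v x) + fs (- \<psi> x) + \<psi> x * v x\<close>, which is nonnegative and forces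
  \<open>v x = k (- \<psi> x)\<close> where it vanishes. The obstacle is the transport term of
  \<open>J\<close>: the c-transform is concave in \<psi> but not differentiable. It is therefore
  never linearised; only the \<open>fs\<close> term is, and the inequality that remains, valid
  against every competitor, already says that \<psi> maximises the Kantorovich functional. The
  Kantorovich value ignores additive constants whereas \<open>J\<close> does not. This fixes the
  constant in \<psi>: stationarity under constant shifts is the statement that \<open>u\<close> has
  mass one. Competitors are bounded Borel functions rather than continuous ones, because marginals
  are tested with indicators and potentials are altered on null sets.\<close>

text \<open>The minimiser is read off the dual problem, which is to maximise
  \<open>J(\<psi>) = \<integral> \<psi>\<^sup>c d\<nu> - \<integral>\<^sub>\<Omega> f\<^sup>*(-\<psi>) dx\<close>. Replacing \<open>\<psi>\<close> by \<open>min(\<psi>, 0)\<^sup>c\<^sup>c\<close> does not decrease \<open>J\<close>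
  and gives equi-Lipschitz nonpositive functions, so by Arzela-Ascoli a c-concave maximiser
  \<open>\<psi> \<le> 0\<close> exists. Since \<open>\<psi> \<mapsto> \<psi>\<^sup>c\<close> is concave and \<open>f\<^sup>*\<close> is differentiable with derivative
  \<open>k\<close>, the first-order condition says that \<open>u = k(-\<psi>)\<close> is a probability density and that
  \<open>\<psi>\<close> maximises \<open>\<integral> \<phi> u dx + \<integral> \<phi>\<^sup>c d\<nu>\<close>. With Kantorovich duality the energy of
  \<open>u\<close> equals \<open>J(\<psi>)\<close>, while Young's inequality bounds every energy below by \<open>J(\<psi>)\<close>, with
  equality only for the density \<open>k(-\<psi>)\<close>. Only near-optimal plans are needed for duality, and the
  entropically regularised problem provides them in closed form.\<close>

section \<open>Legendre transform of the internal energy\<close>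

locale internal_energy =
  fixes f fd :: "real \<Rightarrow> real"
  assumes standing: "standing_f f fd"
begin

lemma f_nonneg: "0 \<le> t \<Longrightarrow> 0 \<le> f t"
  and f_0: "f 0 = 0" and fd_0: "fd 0 = 0"
  and fd_cont: "continuous_on {0..} fd"
  and f_deriv: "0 \<le> t \<Longrightarrow> (f has_real_derivative fd t) (at t within {0..})"
  using standing unfolding standing_f_def by auto

lemma f_strict:
  assumes "0 \<le> x" "0 \<le> y" "x \<noteq> y" "0 < t" "t < 1"
  shows "f (t * x + (1 - t) * y) < t * f x + (1 - t) * f y"
  using standing assms unfolding standing_f_def strictly_convex_on_def by auto

lemma f_cont: "continuous_on {0..} f"
  by (rule DERIV_continuous_on[where D=fd]) (auto intro: f_deriv)

lemma f_convex: "convex_on {0..} f"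
proof (intro convex_onI)
  fix t x y :: real
  assume *: "0 < t" "t < 1" "x \<in> {0..}" "y \<in> {0..}"
  show "f ((1 - t) *\<^sub>R x + t *\<^sub>R y) \<le> (1 - t) * f x + t * f y"
  proof (cases "x = y")
    case True
    then show ?thesis by (simp add: algebra_simps)
  next
    case False
    then show ?thesis using f_strict[of y x t] * by (simp add: add.commute)
  qed
qed simp

lemma f_above_tangent:
  assumes "0 \<le> s" "0 \<le> t"
  shows "f s + fd s * (t - s) \<le> f t"
\<comment> \<open>The general tangent inequality concerns interior points of \<open>{0..}\<close>;
  at the endpoint, \<open>f 0 = 0\<close> and \<open>fd 0 = 0\<close> reduce the claim to
  \<open>0 \<le> f t\<close>.\<close>
proof (cases "s = 0")
  case True
  then show ?thesis using f_0 fd_0 f_nonneg[OF assms(2)] by simp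
next
  case False
  then have "s \<in> interior {0..}" using assms by (simp add: interior_real_atLeast)
  then have "f t - f s \<ge> fd s * (t - s)"
    using assms f_convex f_deriv[OF assms(1)]
    by (intro convex_on_imp_above_tangent[where A="{0..}"]) auto
  then show ?thesis by simp
qed

text \<open>The tangent at \<open>s\<close> is compared with \<open>f\<close> at the midpoint of
  \<open>s\<close> and \<open>t\<close>, where strict convexity leaves a gap.\<close>

lemma f_above_tangent_strict:
  assumes "0 \<le> s" "0 \<le> t" "s \<noteq> t"
  shows "f s + fd s * (t - s) < f t"
proof -
  have "f (1/2 * s + (1 - 1/2) * t) < 1/2 * f s + (1 - 1/2) * f t"
    using assms by (intro f_strict) auto
  moreover have "f s + fd s * ((1/2 * s + (1 - 1/2) * t) - s) \<le> f (1/2 * s + (1 - 1/2) * t)"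
    using assms by (intro f_above_tangent) auto
  ultimately show ?thesis by (simp add: field_simps)
qed

lemma fd_strict_mono:
  assumes "0 \<le> s" "s < t"
  shows "fd s < fd t"
proof -
  have "f s + fd s * (t - s) < f t" "f t + fd t * (s - t) < f s"
    using assms by (auto intro!: f_above_tangent_strict)
  then have "0 < (fd t - fd s) * (t - s)" by (simp add: algebra_simps)
  then show ?thesis using assms by (simp add: zero_less_mult_iff)
qed

lemma fd_inj: "inj_on fd {0..}"
proof (rule inj_onI)
  fix x y assume "x \<in> {0..}" "y \<in> {0..}" "fd x = fd y"
  then show "x = y" using fd_strict_mono[of x y] fd_strict_mono[of y x] by force
qed

text \<open>The tangent at \<open>t\<close>, evaluated at 0, gives
  \<open>f t / t \<le> fd t\<close>, so superlinear growth makes \<open>fd\<close> unbounded; the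
  intermediate value theorem does the rest.\<close>

lemma fd_surj:
  assumes "0 \<le> s"
  shows "\<exists>t\<ge>0. fd t = s"
proof -
  have "filterlim (\<lambda>t. f t / t) at_top at_top"
    using standing unfolding standing_f_def by auto
  then have "eventually (\<lambda>t. s \<le> f t / t) at_top"
    by (simp add: filterlim_at_top)
  moreover have "eventually (\<lambda>t::real. 0 < t) at_top" by (rule eventually_gt_at_top)
  ultimately have "eventually (\<lambda>t. s \<le> f t / t \<and> 0 < t) at_top" by eventually_elim simp
  then obtain t where t: "s \<le> f t / t" "0 < t"
    by (auto simp: eventually_at_top_linorder)
  have "f t + fd t * (0 - t) \<le> f 0" using t by (intro f_above_tangent) auto
  then have "f t / t \<le> fd t" using t f_0 by (simp add: field_simps)
  then have "\<exists>x\<ge>0. x \<le> t \<and> fd x = s"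
    using t assms fd_0 by (intro IVT' continuous_on_subset[OF fd_cont]) auto
  then show ?thesis by blast
qed

text \<open>\<open>kinv\<close> continued by 0 to the negative half-line, so that
  \<open>K (- \<phi> x)\<close> makes sense for test functions of either sign.\<close>

definition K :: "real \<Rightarrow> real" where
  "K s = kinv fd (max s 0)"

text \<open>The Legendre transform of \<open>f\<close>, extended by \<open>0\<close> to the negative half-line.\<close>

definition fs :: "real \<Rightarrow> real" where
  "fs s = max s 0 * K s - f (K s)"

lemma K_nonneg: "0 \<le> K s" and fd_K: "fd (K s) = max s 0"
proof -
  obtain t where t: "t \<ge> 0" "fd t = max s 0" using fd_surj[of "max s 0"] by auto
  then have "K s = t"
    unfolding K_def kinv_def t(2)[symmetric] by (intro the_inv_into_f_f fd_inj) auto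
  then show "0 \<le> K s" "fd (K s) = max s 0" using t by auto
qed

lemma K_eq: "0 \<le> s \<Longrightarrow> K s = kinv fd s"
  by (simp add: K_def max_def)

text \<open>Together with its mirror image below, this translates rays for \<open>K\<close> into
  rays for \<open>max s 0\<close>; monotonicity and continuity of \<open>K\<close> are read off from
  it.\<close>

lemma K_less_iff: "0 \<le> t \<Longrightarrow> K s < t \<longleftrightarrow> max s 0 < fd t"
  using fd_strict_mono[of "K s" t] fd_strict_mono[of t "K s"] K_nonneg[of s] fd_K[of s]
  by (cases "K s" t rule: linorder_cases) auto

lemma less_K_iff: "0 \<le> t \<Longrightarrow> t < K s \<longleftrightarrow> fd t < max s 0"
  using fd_strict_mono[of "K s" t] fd_strict_mono[of t "K s"] K_nonneg[of s] fd_K[of s]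
  by (cases "K s" t rule: linorder_cases) auto

lemma K_mono: "s \<le> s' \<Longrightarrow> K s \<le> K s'"
  using less_K_iff[OF K_nonneg, of s' s] fd_K[of s'] by (auto simp: not_less[symmetric])

lemma K_cont: "continuous_on UNIV K"
  unfolding continuous_on_def
proof (intro ballI order_tendstoI)
  have m: "((\<lambda>s. max s 0) \<longlongrightarrow> max s 0) (at s within UNIV)" for s :: real
    by (intro tendsto_intros)
  fix s a assume a: "a < K s"
  show "\<forall>\<^sub>F x in at s within UNIV. a < K x"
  proof (cases "a < 0")
    case True
    then have "a < K x" for x using K_nonneg[of x] by simp
    then show ?thesis by simp
  next
    case False
    then have "fd a < max s 0" using a less_K_iff by simp
    then have "\<forall>\<^sub>F x in at s within UNIV. fd a < max x 0" by (rule order_tendstoD(1)[OF m])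
    then show ?thesis using False less_K_iff by simp
  qed
next
  have m: "((\<lambda>s. max s 0) \<longlongrightarrow> max s 0) (at s within UNIV)" for s :: real
    by (intro tendsto_intros)
  fix s a assume a: "K s < a"
  then have a0: "0 \<le> a" using K_nonneg[of s] by simp
  then have "max s 0 < fd a" using a K_less_iff by blast
  then have "\<forall>\<^sub>F x in at s within UNIV. max x 0 < fd a" by (rule order_tendstoD(2)[OF m])
  then show "\<forall>\<^sub>F x in at s within UNIV. K x < a" using a0 K_less_iff by simp
qed

text \<open>The tangent of \<open>f\<close> at \<open>K s\<close> has slope \<open>max s 0\<close>;
  since \<open>t \<ge> 0\<close>, a negative \<open>s\<close> in its place only lowers the left
  side.\<close>

lemma young:
  assumes "0 \<le> t"
  shows "s * t \<le> f t + fs s"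
proof -
  have "f (K s) + fd (K s) * (t - K s) \<le> f t"
    using assms K_nonneg by (intro f_above_tangent) auto
  then have "max s 0 * t \<le> f t + fs s" by (simp add: fs_def fd_K algebra_simps)
  moreover have "s * t \<le> max s 0 * t" using assms by (intro mult_right_mono) auto
  ultimately show ?thesis by simp
qed

lemma young_strict:
  assumes "0 \<le> t" "t \<noteq> K s"
  shows "s * t < f t + fs s"
proof -
  have "f (K s) + fd (K s) * (t - K s) < f t"
    using assms K_nonneg by (intro f_above_tangent_strict) auto
  then have "max s 0 * t < f t + fs s" by (simp add: fs_def fd_K algebra_simps)
  moreover have "s * t \<le> max s 0 * t" using assms by (intro mult_right_mono) auto
  ultimately show ?thesis by simp
qed

lemma K_neg: "s \<le> 0 \<Longrightarrow> K s = 0"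
  using less_K_iff[of 0 s] K_nonneg[of s] fd_0 by (auto simp: order_less_le)

lemma young_eq: "s * K s = f (K s) + fs s"
  by (cases "s \<le> 0") (auto simp: fs_def K_neg max_def)

lemma fs_max: "fs (max s 0) = fs s"
  by (simp add: fs_def K_def)

lemma fs_0: "fs 0 = 0"
  by (simp add: fs_def K_neg f_0)

text \<open>Young's inequality at \<open>s'\<close> against its equality case at \<open>s\<close>.
  In this form, together with its continuity, \<open>K\<close> acts as the derivative of
  \<open>fs\<close>.\<close>

lemma fs_subgradient: "K s * (s' - s) \<le> fs s' - fs s"
  using young[OF K_nonneg, of s' s] young_eq[of s] by (simp add: algebra_simps)

lemma fs_mono: "s \<le> s' \<Longrightarrow> fs s \<le> fs s'"
  using fs_subgradient[of s s'] K_nonneg[of s] mult_nonneg_nonneg[of "K s" "s' - s"] by linarith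

lemma fs_nonneg: "0 \<le> fs s"
  using young[of 0 s] f_0 by simp

lemma fs_lipschitz:
  assumes "s \<le> M" "s' \<le> M"
  shows "\<bar>fs s - fs s'\<bar> \<le> K M * \<bar>s - s'\<bar>"
proof -
  have *: "fs b - fs a \<le> K M * \<bar>b - a\<bar>" if "b \<le> M" for a b
  proof -
    have "fs b - fs a \<le> K b * (b - a)" using fs_subgradient[of b a] by (simp add: algebra_simps)
    also have "\<dots> \<le> K b * \<bar>b - a\<bar>" using K_nonneg by (intro mult_left_mono) auto
    also have "\<dots> \<le> K M * \<bar>b - a\<bar>" using K_mono[OF that] by (intro mult_right_mono) auto
    finally show ?thesis .
  qed
  from *[of s s'] *[of s' s] assms show ?thesis by (simp add: abs_minus_commute abs_le_iff)
qed

lemma fs_cont: "continuous_on UNIV fs"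
proof -
  have eq: "fs = (\<lambda>s. max s 0 * K s - f (K s))" by (auto simp: fs_def)
  have "continuous_on UNIV (\<lambda>s. f (K s))"
    by (rule continuous_on_compose2[OF f_cont K_cont]) (auto simp: K_nonneg)
  then show ?thesis unfolding eq by (intro continuous_intros K_cont)
qed

lemma f_max_cont: "continuous_on UNIV (\<lambda>t. f (max t 0))"
  by (rule continuous_on_compose2[OF f_cont]) (auto intro!: continuous_intros)

lemma measurable_f_comp:
  assumes [measurable]: "v \<in> borel_measurable M" and "\<And>x. 0 \<le> v x"
  shows "(\<lambda>x. f (v x)) \<in> borel_measurable M"
proof -
  have [measurable]: "(\<lambda>t. f (max t 0)) \<in> borel_measurable borel"
    using f_max_cont by (rule borel_measurable_continuous_onI)
  have "(\<lambda>x. f (max (v x) 0)) \<in> borel_measurable M" by measurable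
  then show ?thesis using assms(2) by (simp add: max_absorb1)
qed

end

section \<open>Lipschitz costs and the c-transform\<close>

text \<open>Equal total mass turns the inequality around on complements, so a marginal has to be
  bounded on one side only.\<close>

lemma prob_measure_eqI_le:
  assumes "prob_space M" "prob_space N" and sets: "sets M = sets N"
    and le: "\<And>A. A \<in> sets M \<Longrightarrow> measure M A \<le> measure N A"
  shows "M = N"
proof (rule measure_eqI[OF sets])
  interpret M: prob_space M by fact
  interpret N: prob_space N by fact
  fix A assume A: "A \<in> sets M"
  have "measure M (space M - A) \<le> measure N (space M - A)" using A by (intro le) auto
  then have "1 - measure M A \<le> 1 - measure N A"
    using M.prob_compl[of A] N.prob_compl[of A] A sets sets_eq_imp_space_eq[OF sets] by auto
  then have "measure M A = measure N A" using le[OF A] by simp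
  then show "emeasure M A = emeasure N A"
    by (simp add: M.emeasure_eq_measure N.emeasure_eq_measure)
qed

section \<open>Bounded Borel test functions\<close>

definition bborel :: "('a::euclidean_space \<Rightarrow> real) set" where
  "bborel = {\<phi>. \<phi> \<in> borel_measurable borel \<and> (\<exists>b. \<forall>x. \<bar>\<phi> x\<bar> \<le> b)}"

lemma bborelI: "\<phi> \<in> borel_measurable borel \<Longrightarrow> (\<And>x. \<bar>\<phi> x\<bar> \<le> b) \<Longrightarrow> \<phi> \<in> bborel"
  by (auto simp: bborel_def)

lemma bborel_measurable: "\<phi> \<in> bborel \<Longrightarrow> \<phi> \<in> borel_measurable borel"
  by (simp add: bborel_def)

lemma bborelE:
  assumes "\<phi> \<in> bborel" obtains b where "\<And>x. \<bar>\<phi> x\<bar> \<le> b" "0 \<le> b"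
proof -
  obtain b where b: "\<And>x. \<bar>\<phi> x\<bar> \<le> b" using assms by (auto simp: bborel_def)
  then have "0 \<le> b" using abs_ge_zero[of "\<phi> 0"] b[of 0] by linarith
  with b show ?thesis by (rule that)
qed

lemma bborel_const: "(\<lambda>x. a) \<in> bborel"
  by (rule bborelI[of _ "\<bar>a\<bar>"]) auto

text \<open>Indicators are why the class is Borel: a marginal is identified by perturbing a
  potential by a multiple of an indicator, and duality changes a potential on a null set.\<close>

lemma bborel_indicator: "B \<in> sets borel \<Longrightarrow> indicat_real B \<in> bborel"
  by (rule bborelI[of _ 1]) (auto simp: indicator_def)

lemma bborel_add:
  assumes "\<phi> \<in> bborel" "\<psi> \<in> bborel" shows "(\<lambda>x. \<phi> x + \<psi> x) \<in> bborel"
proof -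
  from assms obtain a b where "\<And>x. \<bar>\<phi> x\<bar> \<le> a" "\<And>x. \<bar>\<psi> x\<bar> \<le> b" by (auto simp: bborel_def)
  then have "\<And>x. \<bar>\<phi> x + \<psi> x\<bar> \<le> a + b" by (meson abs_triangle_ineq add_mono order_trans)
  moreover note [measurable] = assms[THEN bborel_measurable]
  ultimately show ?thesis by (intro bborelI) measurable
qed

lemma bborel_mult:
  assumes "\<phi> \<in> bborel" "\<psi> \<in> bborel" shows "(\<lambda>x. \<phi> x * \<psi> x) \<in> bborel"
proof -
  from assms obtain a b where "\<And>x. \<bar>\<phi> x\<bar> \<le> a" "\<And>x. \<bar>\<psi> x\<bar> \<le> b" by (auto simp: bborel_def)
  then have "\<And>x. \<bar>\<phi> x * \<psi> x\<bar> \<le> a * b"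
    unfolding abs_mult by (intro mult_mono) (auto intro: order_trans[OF abs_ge_zero])
  moreover note [measurable] = assms[THEN bborel_measurable]
  ultimately show ?thesis by (intro bborelI) measurable
qed

lemma bborel_cmult: "\<phi> \<in> bborel \<Longrightarrow> (\<lambda>x. a * \<phi> x) \<in> bborel"
  using bborel_mult[OF bborel_const] .

lemma bborel_uminus: "\<phi> \<in> bborel \<Longrightarrow> (\<lambda>x. - \<phi> x) \<in> bborel"
  using bborel_cmult[of \<phi> "-1"] by simp

lemma bborel_diff: "\<phi> \<in> bborel \<Longrightarrow> \<psi> \<in> bborel \<Longrightarrow> (\<lambda>x. \<phi> x - \<psi> x) \<in> bborel"
  using bborel_add[OF _ bborel_uminus, of \<phi> \<psi>] by simp

lemma bborel_comp:
  assumes "\<phi> \<in> bborel" and h: "continuous_on UNIV (h :: real \<Rightarrow> real)"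
  shows "(\<lambda>x. h (\<phi> x)) \<in> bborel"
proof -
  obtain a where a: "\<And>x. \<bar>\<phi> x\<bar> \<le> a" using assms(1) bborelE by blast
  have "compact (h ` {-a..a})" by (intro compact_continuous_image continuous_on_subset[OF h]) auto
  then obtain b where b: "\<And>y. y \<in> h ` {-a..a} \<Longrightarrow> \<bar>y\<bar> \<le> b"
    using compact_imp_bounded bounded_iff by (metis real_norm_def)
  have "\<bar>h (\<phi> x)\<bar> \<le> b" for x using a[of x] by (intro b imageI) auto
  moreover have "(\<lambda>x. h (\<phi> x)) \<in> borel_measurable borel"
    using bborel_measurable[OF assms(1)] borel_measurable_continuous_onI[OF h] by measurable
  ultimately show ?thesis by (rule bborelI[rotated])
qed

lemma bborel_lipschitz:
  assumes lip: "\<And>x y. \<bar>\<phi> x - \<phi> y\<bar> \<le> L * dist x y" and osc: "\<And>x y. \<bar>\<phi> x - \<phi> y\<bar> \<le> R"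
  shows "\<phi> \<in> bborel"
proof (rule bborelI)
  have "\<bar>\<phi> x\<bar> \<le> \<bar>\<phi> 0\<bar> + R" for x using osc[of x 0] by linarith
  then show "\<And>x. \<bar>\<phi> x\<bar> \<le> \<bar>\<phi> 0\<bar> + R" .
  have "(max L 0)-lipschitz_on UNIV \<phi>"
  proof (rule lipschitz_onI)
    fix x y show "dist (\<phi> x) (\<phi> y) \<le> max L 0 * dist x y"
      using lip[of x y] mult_right_mono[of L "max L 0" "dist x y"] by (simp add: dist_real_def)
  qed simp
  then show "\<phi> \<in> borel_measurable borel"
    by (intro borel_measurable_continuous_onI lipschitz_on_continuous_on)
qed

lemma integrable_bborel:
  assumes "finite_measure M" "sets M = sets borel" "\<phi> \<in> bborel"
  shows "integrable M \<phi>"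
proof -
  interpret finite_measure M by fact
  obtain b where "\<And>x. \<bar>\<phi> x\<bar> \<le> b" using assms(3) bborelE by blast
  moreover have "\<phi> \<in> borel_measurable M"
    using bborel_measurable[OF assms(3)] measurable_cong_sets[OF assms(2) refl] by blast
  ultimately show ?thesis by (intro integrable_const_bound[of _ b]) auto
qed

text \<open>The estimates are required on the whole space, so that transforms are bounded Lipschitz
  functions everywhere and lie in \<open>bborel\<close> without extension arguments.\<close>

locale lipschitz_cost =
  fixes \<Omega> :: "'a::euclidean_space set" and c :: "'a \<Rightarrow> 'a \<Rightarrow> real" and L R :: real
  assumes compact_dom: "compact \<Omega>" and dom_nonempty: "\<Omega> \<noteq> {}"
    and c_nonneg: "0 \<le> c x y" and c_le: "c x y \<le> R" and c_sym: "c x y = c y x"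
    and c_lip: "\<bar>c x y - c x' y\<bar> \<le> L * dist x x'" and L_nonneg: "0 \<le> L"
begin

lemma c_lip': "\<bar>c x y - c x y'\<bar> \<le> L * dist y y'"
  using c_lip[of y x y'] by (simp add: c_sym[of x])

lemma R_nonneg: "0 \<le> R"
  using c_nonneg[of undefined undefined] c_le[of undefined undefined] by linarith

lemma c_measurable: "case_prod c \<in> borel_measurable (borel \<Otimes>\<^sub>M borel)"
proof -
  have "(2 * L)-lipschitz_on UNIV (\<lambda>z. c (fst z) (snd z))"
  proof (rule lipschitz_onI)
    fix z w :: "'a \<times> 'a"
    have "\<bar>c (fst z) (snd z) - c (fst w) (snd w)\<bar> \<le> L * dist (fst z) (fst w) + L * dist (snd z) (snd w)"
      using c_lip[of "fst z" "snd z" "fst w"] c_lip'[of "fst w" "snd z" "snd w"] by linarith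
    also have "\<dots> \<le> L * dist z w + L * dist z w"
      using L_nonneg by (intro add_mono mult_left_mono dist_fst_le dist_snd_le)
    finally show "dist (c (fst z) (snd z)) (c (fst w) (snd w)) \<le> 2 * L * dist z w"
      by (simp add: dist_real_def)
  qed (use L_nonneg in simp)
  then have "(\<lambda>z. c (fst z) (snd z)) \<in> borel_measurable borel"
    by (intro borel_measurable_continuous_onI lipschitz_on_continuous_on)
  then show ?thesis by (simp add: borel_prod case_prod_beta')
qed

lemma c_measurable_1 [measurable]: "(\<lambda>x. c x y) \<in> borel_measurable borel"
proof -
  have "L-lipschitz_on UNIV (\<lambda>x. c x y)"
    by (rule lipschitz_onI) (auto simp: dist_real_def c_lip L_nonneg)
  then show ?thesis by (intro borel_measurable_continuous_onI lipschitz_on_continuous_on)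
qed

section \<open>The c-transform: regularity, monotonicity, stability\<close>

definition ct :: "('a \<Rightarrow> real) \<Rightarrow> 'a \<Rightarrow> real" where
  "ct \<phi> y = (INF x\<in>\<Omega>. c x y - \<phi> x)"

lemma ct_bdd:
  assumes "bdd_above (\<phi> ` \<Omega>)"
  shows "bdd_below ((\<lambda>x. c x y - \<phi> x) ` \<Omega>)"
proof -
  obtain b where "\<And>x. x \<in> \<Omega> \<Longrightarrow> \<phi> x \<le> b" using assms by (auto simp: bdd_above_def)
  then show ?thesis using c_nonneg by (intro bdd_belowI2[of _ "-b"]) (smt (verit))
qed

lemma ct_le: "bdd_above (\<phi> ` \<Omega>) \<Longrightarrow> x \<in> \<Omega> \<Longrightarrow> ct \<phi> y \<le> c x y - \<phi> x"
  unfolding ct_def by (intro cINF_lower ct_bdd)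

lemma ct_ge: "(\<And>x. x \<in> \<Omega> \<Longrightarrow> a \<le> c x y - \<phi> x) \<Longrightarrow> a \<le> ct \<phi> y"
  unfolding ct_def using dom_nonempty by (intro cINF_greatest)

text \<open>The one comparison behind the estimates below: moving the point gives the Lipschitz and
  oscillation bounds, changing the function gives monotonicity and sup-norm stability.\<close>

lemma ct_compare:
  assumes "bdd_above (\<phi> ` \<Omega>)" "\<And>x. x \<in> \<Omega> \<Longrightarrow> \<psi> x - c x y' \<le> \<phi> x - c x y + d"
  shows "ct \<phi> y \<le> ct \<psi> y' + d"
proof -
  have "ct \<phi> y - d \<le> ct \<psi> y'"
  proof (rule ct_ge)
    fix x assume "x \<in> \<Omega>"
    then show "ct \<phi> y - d \<le> c x y' - \<psi> x"
      using assms(2)[of x] ct_le[OF assms(1), of x y] by simp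
  qed
  then show ?thesis by simp
qed

lemma ct_lip:
  assumes "bdd_above (\<phi> ` \<Omega>)" shows "\<bar>ct \<phi> x - ct \<phi> y\<bar> \<le> L * dist x y"
proof -
  have "ct \<phi> u \<le> ct \<phi> v + L * dist u v" for u v
  proof (rule ct_compare[OF assms])
    fix x show "\<phi> x - c x v \<le> \<phi> x - c x u + L * dist u v"
      using c_lip'[of x u v] by linarith
  qed
  from this[of x y] this[of y x] show ?thesis by (simp add: dist_commute abs_le_iff)
qed

text \<open>The bound comes from \<open>0 \<le> c \<le> R\<close> and is independent of the size of
  \<phi>, so a transform is controlled everywhere by its value at a single point.\<close>

lemma ct_osc:
  assumes "bdd_above (\<phi> ` \<Omega>)" shows "\<bar>ct \<phi> x - ct \<phi> y\<bar> \<le> R"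
proof -
  have "ct \<phi> u \<le> ct \<phi> v + R" for u v
  proof (rule ct_compare[OF assms])
    fix x show "\<phi> x - c x v \<le> \<phi> x - c x u + R"
      using c_nonneg[of x v] c_le[of x u] by linarith
  qed
  from this[of x y] this[of y x] show ?thesis by (simp add: abs_le_iff)
qed

lemma ct_bborel: "bdd_above (\<phi> ` \<Omega>) \<Longrightarrow> ct \<phi> \<in> bborel"
  using ct_lip ct_osc by (rule bborel_lipschitz)

lemma bborel_bdd: "\<phi> \<in> bborel \<Longrightarrow> bdd_above (\<phi> ` \<Omega>)"
proof -
  assume "\<phi> \<in> bborel"
  then obtain b where b: "\<And>x. \<bar>\<phi> x\<bar> \<le> b" using bborelE by blast
  have "\<phi> x \<le> b" for x using b[of x] by simp
  then show ?thesis by (intro bdd_aboveI2)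
qed

lemma ct_ct_ge:
  assumes "bdd_above (\<phi> ` \<Omega>)" "x \<in> \<Omega>"
  shows "\<phi> x \<le> ct (ct \<phi>) x"
proof (rule ct_ge)
  fix y show "\<phi> x \<le> c y x - ct \<phi> y"
    using ct_le[OF assms, of y] c_sym[of x y] by simp
qed

lemma ct_antimono:
  assumes "bdd_above (\<psi> ` \<Omega>)" "\<And>x. x \<in> \<Omega> \<Longrightarrow> \<phi> x \<le> \<psi> x"
  shows "ct \<psi> y \<le> ct \<phi> y"
  using ct_compare[OF assms(1), of \<phi> y y 0] assms(2) by simp

lemma ct_dist:
  assumes "bdd_above (\<phi> ` \<Omega>)" "bdd_above (\<psi> ` \<Omega>)" "\<And>x. x \<in> \<Omega> \<Longrightarrow> \<bar>\<phi> x - \<psi> x\<bar> \<le> d"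
  shows "\<bar>ct \<phi> y - ct \<psi> y\<bar> \<le> d"
proof -
  have "ct \<phi> y \<le> ct \<psi> y + d"
    using assms(3) by (intro ct_compare assms) (smt (verit, best))
  moreover have "ct \<psi> y \<le> ct \<phi> y + d"
    using assms(3) by (intro ct_compare assms) (smt (verit, best))
  ultimately show ?thesis by simp
qed

text \<open>A transform is an infimum of functions affine in \<phi>.\<close>

lemma ct_concave:
  assumes "bdd_above (\<phi> ` \<Omega>)" "bdd_above (\<psi> ` \<Omega>)" "0 \<le> t" "t \<le> 1"
  shows "(1 - t) * ct \<phi> y + t * ct \<psi> y \<le> ct (\<lambda>x. (1 - t) * \<phi> x + t * \<psi> x) y"
proof (rule ct_ge)
  fix x assume "x \<in> \<Omega>"
  then have "(1 - t) * ct \<phi> y + t * ct \<psi> y \<le> (1 - t) * (c x y - \<phi> x) + t * (c x y - \<psi> x)"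
    using assms by (intro add_mono mult_left_mono ct_le) auto
  then show "(1 - t) * ct \<phi> y + t * ct \<psi> y \<le> c x y - ((1 - t) * \<phi> x + t * \<psi> x)"
    by (simp add: algebra_simps)
qed

text \<open>The constraints live on \<Omega>, where uniform limits are found; elsewhere just enough
  is asked to integrate.\<close>

definition lip_class :: "real \<Rightarrow> real \<Rightarrow> ('a \<Rightarrow> real) set" where
  "lip_class a b = {\<phi> \<in> bborel. L-lipschitz_on \<Omega> \<phi> \<and> (\<forall>x\<in>\<Omega>. a \<le> \<phi> x \<and> \<phi> x \<le> b)}"

text \<open>Arzela-Ascoli supplies a uniform limit of a maximising sequence, and sup-norm Lipschitz
  dependence carries the values of \<open>J\<close> along. Serves both the regularised and the final
  dual functional.\<close>

lemma lip_class_attains_max: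
  fixes J :: "('a \<Rightarrow> real) \<Rightarrow> real"
  assumes ne: "lip_class a b \<noteq> {}"
    and J: "\<And>\<phi> \<psi> d. \<phi> \<in> lip_class a b \<Longrightarrow> \<psi> \<in> lip_class a b \<Longrightarrow>
        (\<And>x. x \<in> \<Omega> \<Longrightarrow> \<bar>\<phi> x - \<psi> x\<bar> \<le> d) \<Longrightarrow> \<bar>J \<phi> - J \<psi>\<bar> \<le> C * d"
  shows "\<exists>\<psi>\<in>lip_class a b. \<forall>\<phi>\<in>lip_class a b. J \<phi> \<le> J \<psi>"
proof -
  let ?F = "lip_class a b"
  \<comment> \<open>In \<open>ereal\<close> the supremum makes sense before \<open>J\<close> is
    known to be bounded; its finiteness comes out at the end, from the limit.\<close>
  let ?A = "(\<lambda>\<phi>. ereal (J \<phi>)) ` ?F"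
  obtain s :: "nat \<Rightarrow> ereal" where s: "incseq s" "range s \<subseteq> ?A" "Sup ?A = (SUP i. s i)"
    using Sup_countable_SUP[of ?A] ne by auto
  then have "\<forall>n. \<exists>\<phi>\<in>?F. s n = ereal (J \<phi>)" by auto
  then obtain \<F> where F: "\<And>n. \<F> n \<in> ?F" "\<And>n. s n = ereal (J (\<F> n))" by metis
  have lip: "\<bar>\<F> n x - \<F> n y\<bar> \<le> L * norm (x - y)" if "x \<in> \<Omega>" "y \<in> \<Omega>" for n x y
    using F(1)[of n] that by (auto simp: lip_class_def lipschitz_on_def dist_norm)
  have bd: "a \<le> \<F> n x" "\<F> n x \<le> b" if "x \<in> \<Omega>" for n x
    using F(1)[of n] that by (auto simp: lip_class_def)
  obtain g k where g: "continuous_on \<Omega> g" and k: "strict_mono (k :: nat \<Rightarrow> nat)"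
    and lim: "\<And>e. 0 < e \<Longrightarrow> \<exists>N. \<forall>n x. n \<ge> N \<and> x \<in> \<Omega> \<longrightarrow> norm (\<F> (k n) x - g x) < e"
  proof (rule Arzela_Ascoli[OF compact_dom, of \<F> "max \<bar>a\<bar> \<bar>b\<bar>"])
    fix n x assume "x \<in> \<Omega>"
    then show "norm (\<F> n x) \<le> max \<bar>a\<bar> \<bar>b\<bar>" using bd[of x n] by auto
  next
    fix x e assume x: "x \<in> \<Omega>" and e: "0 < (e::real)"
    \<comment> \<open>\<open>L + 1\<close> guards against \<open>L = 0\<close>.\<close>
    have "norm (\<F> n x - \<F> n y) < e" if y: "y \<in> \<Omega>" "norm (x - y) < e / (L + 1)" for n y
    proof -
      have "norm (\<F> n x - \<F> n y) \<le> L * norm (x - y)" using lip[OF x y(1)] by simp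
      also have "\<dots> \<le> (L + 1) * norm (x - y)" by (simp add: algebra_simps)
      also have "\<dots> < e" using y(2) L_nonneg by (simp add: field_simps)
      finally show ?thesis .
    qed
    then show "\<exists>d>0. \<forall>n y. y \<in> \<Omega> \<and> norm (x - y) < d \<longrightarrow> norm (\<F> n x - \<F> n y) < e"
      using e L_nonneg by (intro exI[of _ "e / (L + 1)"]) auto
  qed blast
  \<comment> \<open>The limit is meaningful on \<Omega> alone; extension by zero makes it Borel and
    bounded.\<close>
  define \<psi> where "\<psi> x = indicat_real \<Omega> x *\<^sub>R g x" for x
  have \<psi>: "\<psi> x = g x" if "x \<in> \<Omega>" for x using that by (simp add: \<psi>_def)
  have pt: "(\<lambda>n. \<F> (k n) x) \<longlonglongrightarrow> g x" if "x \<in> \<Omega>" for x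
    using lim that by (intro LIMSEQ_I) blast
  have gbd: "a \<le> g x \<and> g x \<le> b" if "x \<in> \<Omega>" for x
    using LIMSEQ_le_const[OF pt[OF that], of a] LIMSEQ_le_const2[OF pt[OF that], of b] bd[OF that]
    by auto
  have "\<psi> \<in> ?F"
    unfolding lip_class_def
  proof (safe intro!: bborelI[of _ "max \<bar>a\<bar> \<bar>b\<bar>"] lipschitz_onI L_nonneg)
    show "\<psi> \<in> borel_measurable borel"
      unfolding \<psi>_def using compact_dom g
      by (intro borel_measurable_continuous_on_indicator) (auto simp: compact_imp_closed)
    show "\<bar>\<psi> x\<bar> \<le> max \<bar>a\<bar> \<bar>b\<bar>" for x using gbd[of x] by (auto simp: \<psi>_def indicator_def)
    show "a \<le> \<psi> x" "\<psi> x \<le> b" if "x \<in> \<Omega>" for x using gbd[OF that] \<psi>[OF that] by auto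
    fix x y assume xy: "x \<in> \<Omega>" "y \<in> \<Omega>"
    have "(\<lambda>n. \<bar>\<F> (k n) x - \<F> (k n) y\<bar>) \<longlonglongrightarrow> \<bar>g x - g y\<bar>"
      using xy by (intro tendsto_intros pt)
    then have "\<bar>g x - g y\<bar> \<le> L * norm (x - y)"
      by (rule LIMSEQ_le_const2) (use lip xy in blast)
    then show "dist (\<psi> x) (\<psi> y) \<le> L * dist x y"
      using xy \<psi> by (simp add: dist_real_def dist_norm)
  qed
  moreover have "(\<lambda>n. J (\<F> (k n))) \<longlonglongrightarrow> J \<psi>"
  proof (rule LIMSEQ_I)
    fix e :: real assume e: "0 < e"
    obtain N where N: "\<And>n x. n \<ge> N \<Longrightarrow> x \<in> \<Omega> \<Longrightarrow> norm (\<F> (k n) x - g x) < e / (\<bar>C\<bar> + 1)"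
      using lim[of "e / (\<bar>C\<bar> + 1)"] e by (auto simp: field_simps)
    have "norm (J (\<F> (k n)) - J \<psi>) < e" if "n \<ge> N" for n
    proof -
      have "\<bar>J (\<F> (k n)) - J \<psi>\<bar> \<le> C * (e / (\<bar>C\<bar> + 1))"
        using N[OF that] \<psi> by (intro J F(1) \<open>\<psi> \<in> ?F\<close>) (auto simp: less_imp_le)
      also have "\<dots> \<le> \<bar>C\<bar> * (e / (\<bar>C\<bar> + 1))" using e by (intro mult_right_mono) auto
      also have "\<dots> < e" using e by (simp add: field_simps)
      finally show ?thesis by simp
    qed
    then show "\<exists>N. \<forall>n\<ge>N. norm (J (\<F> (k n)) - J \<psi>) < e" by blast
  qed
  then have "(\<lambda>n. s (k n)) \<longlonglongrightarrow> ereal (J \<psi>)" by (simp add: F(2))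
  moreover have "(\<lambda>n. s (k n)) \<longlonglongrightarrow> Sup ?A"
    using LIMSEQ_subseq_LIMSEQ[OF LIMSEQ_SUP[OF s(1)] k] s(3) by (simp add: o_def)
  ultimately have "Sup ?A = ereal (J \<psi>)" by (metis LIMSEQ_unique)
  then have "J \<phi> \<le> J \<psi>" if "\<phi> \<in> ?F" for \<phi>
    using Sup_upper[of "ereal (J \<phi>)" ?A] that by auto
  then show ?thesis using \<open>\<psi> \<in> ?F\<close> by blast
qed

end

section \<open>Kantorovich duality by entropic regularisation\<close>

context lipschitz_cost
begin

lemma probs_AE:
  assumes "M \<in> probs \<Omega>" shows "AE x in M. x \<in> \<Omega>"
proof (rule AE_I)
  have s: "sets M = sets borel" using assms by (simp add: probs_def)
  show "{x \<in> space M. \<not> x \<in> \<Omega>} \<subseteq> UNIV - \<Omega>" by auto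
  show "emeasure M (UNIV - \<Omega>) = 0" using assms by (simp add: probs_def)
  show "UNIV - \<Omega> \<in> sets M" unfolding s using compact_dom by (auto simp: compact_imp_closed)
qed

lemma prob_integrable:
  assumes "M \<in> probs \<Omega>" "\<phi> \<in> bborel" shows "integrable M \<phi>"
proof -
  interpret prob_space M using assms(1) by (simp add: probs_def)
  show ?thesis using assms by (intro integrable_bborel) (auto simp: probs_def finite_measure_axioms)
qed

lemma integral_diff_abs_le:
  assumes M: "M \<in> probs \<Omega>" and "\<phi> \<in> bborel" "\<psi> \<in> bborel"
    and le: "\<And>x. x \<in> \<Omega> \<Longrightarrow> \<bar>\<phi> x - \<psi> x\<bar> \<le> d"
  shows "\<bar>(\<integral>x. \<phi> x \<partial>M) - (\<integral>x. \<psi> x \<partial>M)\<bar> \<le> d"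
proof -
  interpret M: prob_space M using M by (simp add: probs_def)
  note int = prob_integrable[OF M]
  have "(\<integral>x. \<phi> x \<partial>M) \<le> (\<integral>x. \<psi> x + d \<partial>M)"
    using probs_AE[OF M]
    by (intro integral_mono_AE int bborel_add bborel_const assms) (auto elim!: eventually_mono dest!: le)
  moreover have "(\<integral>x. \<psi> x \<partial>M) \<le> (\<integral>x. \<phi> x + d \<partial>M)"
    using probs_AE[OF M]
    by (intro integral_mono_AE int bborel_add bborel_const assms) (auto elim!: eventually_mono dest!: le)
  ultimately show ?thesis using int assms by (simp add: M.prob_space abs_le_iff)
qed

text \<open>Log-exp smoothing of \<open>ct\<close>: a soft minimum weighted by \<open>M\<close>,
  approaching the \<open>M\<close>-essential infimum of \<open>c x y - \<phi> x\<close> as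
  \<open>e\<close> tends to 0.\<close>

definition soft :: "real \<Rightarrow> 'a measure \<Rightarrow> ('a \<Rightarrow> real) \<Rightarrow> 'a \<Rightarrow> real" where
  "soft e M \<phi> y = - e * ln (\<integral>x. exp ((\<phi> x - c x y) / e) \<partial>M)"

lemma bborel_exp_cost:
  assumes "\<phi> \<in> bborel"
  shows "(\<lambda>x. exp ((\<phi> x - c x y) / e)) \<in> bborel"
proof -
  have "(\<lambda>x. c x y) \<in> bborel"
    by (rule bborelI[of _ R]) (auto simp: c_nonneg c_le)
  then have "(\<lambda>x. \<phi> x - c x y) \<in> bborel" by (rule bborel_diff[OF assms])
  then show ?thesis
    by (rule bborel_comp[of _ "\<lambda>s. exp (s / e)"]) (auto intro!: continuous_intros simp: divide_inverse)
qed

end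

text \<open>Entropic regularisation: the plans \<open>exp ((\<phi> x + \<psi> y - c x y) / e)\<close> times the product
  measure have the right marginals when \<open>(\<phi>, \<psi>)\<close> maximises the smoothed dual functional,
  and their cost is at most the dual value.\<close>

locale entropic = lipschitz_cost +
  fixes e :: real and \<mu> \<nu> :: "'a measure"
  assumes e_pos: "0 < e" and mu: "\<mu> \<in> probs \<Omega>" and nu: "\<nu> \<in> probs \<Omega>"
begin

lemma partition_pos:
  assumes M: "M \<in> probs \<Omega>" and phi: "\<phi> \<in> bborel"
  shows "0 < (\<integral>x. exp ((\<phi> x - c x y) / e) \<partial>M)"
proof -
  interpret prob_space M using M by (simp add: probs_def)
  obtain b where b: "\<And>x. \<bar>\<phi> x\<bar> \<le> b" using phi bborelE by blast
  have "exp ((- b - R) / e) \<le> exp ((\<phi> x - c x y) / e)" for x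
    using b[of x] c_le[of x y] e_pos by (auto intro!: divide_right_mono simp: abs_le_iff)
  then have "exp ((- b - R) / e) \<le> (\<integral>x. exp ((\<phi> x - c x y) / e) \<partial>M)"
    by (intro integral_ge_const prob_integrable[OF M] bborel_exp_cost phi) auto
  then show ?thesis using exp_gt_zero less_le_trans by blast
qed

lemma exp_soft:
  assumes "M \<in> probs \<Omega>" "\<phi> \<in> bborel"
  shows "exp (soft e M \<phi> y / e) * (\<integral>x. exp ((\<phi> x - c x y) / e) \<partial>M) = 1"
  using partition_pos[OF assms, of y] e_pos by (simp add: soft_def exp_minus)

text \<open>Counterpart of \<open>ct_compare\<close>: a shift \<open>d\<close> in the exponent
  multiplies the integral by \<open>exp (d / e)\<close>. The Lipschitz and oscillation bounds that
  follow depend on neither \<open>e\<close> nor \<phi>.\<close>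

lemma soft_compare:
  assumes M: "M \<in> probs \<Omega>" and phi: "\<phi> \<in> bborel" "\<psi> \<in> bborel"
    and le: "\<And>x. x \<in> \<Omega> \<Longrightarrow> \<psi> x - c x y' \<le> \<phi> x - c x y + d"
  shows "soft e M \<phi> y \<le> soft e M \<psi> y' + d"
proof -
  let ?Z = "\<integral>x. exp ((\<phi> x - c x y) / e) \<partial>M"
  let ?Z' = "\<integral>x. exp ((\<psi> x - c x y') / e) \<partial>M"
  have "?Z' \<le> (\<integral>x. exp (d / e) * exp ((\<phi> x - c x y) / e) \<partial>M)"
  proof (rule integral_mono_AE)
    show "integrable M (\<lambda>x. exp ((\<psi> x - c x y') / e))"
      by (intro prob_integrable[OF M] bborel_exp_cost phi)
    show "integrable M (\<lambda>x. exp (d / e) * exp ((\<phi> x - c x y) / e))"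
      by (intro prob_integrable[OF M] bborel_exp_cost bborel_cmult phi)
    show "AE x in M. exp ((\<psi> x - c x y') / e) \<le> exp (d / e) * exp ((\<phi> x - c x y) / e)"
      using probs_AE[OF M]
    proof eventually_elim
      case (elim x)
      have "(\<psi> x - c x y') / e \<le> (\<phi> x - c x y + d) / e"
        using le[OF elim] e_pos by (intro divide_right_mono) auto
      also have "\<dots> = d / e + (\<phi> x - c x y) / e" by (simp add: add_divide_distrib)
      finally show ?case by (simp flip: exp_add)
    qed
  qed
  also have "\<dots> = exp (d / e) * ?Z" by simp
  finally have "ln ?Z' \<le> ln (exp (d / e) * ?Z)"
    using partition_pos[OF M phi(2), of y'] partition_pos[OF M phi(1), of y] by simp
  also have "\<dots> = d / e + ln ?Z" using partition_pos[OF M phi(1), of y] by (simp add: ln_mult)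
  finally have "e * ln ?Z' \<le> e * (d / e + ln ?Z)" using e_pos by (intro mult_left_mono) auto
  then show ?thesis using e_pos by (simp add: soft_def algebra_simps)
qed

lemma soft_lip:
  assumes "M \<in> probs \<Omega>" "\<phi> \<in> bborel"
  shows "\<bar>soft e M \<phi> x - soft e M \<phi> y\<bar> \<le> L * dist x y"
proof -
  have "soft e M \<phi> u \<le> soft e M \<phi> v + L * dist u v" for u v
  proof (rule soft_compare[OF assms assms(2)])
    fix x show "\<phi> x - c x v \<le> \<phi> x - c x u + L * dist u v"
      using c_lip'[of x u v] by linarith
  qed
  from this[of x y] this[of y x] show ?thesis by (simp add: dist_commute abs_le_iff)
qed

lemma soft_osc:
  assumes "M \<in> probs \<Omega>" "\<phi> \<in> bborel"
  shows "\<bar>soft e M \<phi> x - soft e M \<phi> y\<bar> \<le> R"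
proof -
  have "soft e M \<phi> u \<le> soft e M \<phi> v + R" for u v
  proof (rule soft_compare[OF assms assms(2)])
    fix x show "\<phi> x - c x v \<le> \<phi> x - c x u + R"
      using c_nonneg[of x v] c_le[of x u] by linarith
  qed
  from this[of x y] this[of y x] show ?thesis by (simp add: abs_le_iff)
qed

lemma soft_bborel: "M \<in> probs \<Omega> \<Longrightarrow> \<phi> \<in> bborel \<Longrightarrow> soft e M \<phi> \<in> bborel"
  using soft_lip soft_osc by (rule bborel_lipschitz)

definition rho :: "('a \<Rightarrow> real) \<Rightarrow> ('a \<Rightarrow> real) \<Rightarrow> 'a \<Rightarrow> 'a \<Rightarrow> real" where
  "rho \<phi> \<psi> x y = exp ((\<phi> x + \<psi> y - c x y) / e)"

lemma rho_pos: "0 < rho \<phi> \<psi> x y"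
  by (simp add: rho_def)

lemma measurable_rho:
  assumes "M \<in> probs \<Omega>" "N \<in> probs \<Omega>" "\<phi> \<in> bborel" "\<psi> \<in> bborel"
  shows "case_prod (rho \<phi> \<psi>) \<in> borel_measurable (M \<Otimes>\<^sub>M N)"
proof -
  have s: "sets (M \<Otimes>\<^sub>M N) = sets (borel \<Otimes>\<^sub>M borel)"
    using assms by (intro sets_pair_measure_cong) (auto simp: probs_def)
  note [measurable] = bborel_measurable[OF assms(3)] bborel_measurable[OF assms(4)] c_measurable
  have "case_prod (rho \<phi> \<psi>) = (\<lambda>z. exp ((\<phi> (fst z) + \<psi> (snd z) - case_prod c z) / e))"
    by (auto simp: rho_def)
  also have "\<dots> \<in> borel_measurable (borel \<Otimes>\<^sub>M borel)" by measurable
  finally show ?thesis using measurable_cong_sets[OF s refl] by blast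
qed

lemma rho_bound:
  assumes "\<phi> \<in> bborel" "\<psi> \<in> bborel"
  obtains b where "\<And>x y. rho \<phi> \<psi> x y \<le> b"
proof -
  obtain p where p: "\<And>x. \<bar>\<phi> x\<bar> \<le> p" using assms(1) bborelE by blast
  obtain q where q: "\<And>x. \<bar>\<psi> x\<bar> \<le> q" using assms(2) bborelE by blast
  have "rho \<phi> \<psi> x y \<le> exp ((p + q) / e)" for x y
    using p[of x] q[of y] c_nonneg[of x y] e_pos
    by (auto simp: rho_def abs_le_iff intro!: divide_right_mono)
  then show ?thesis by (rule that)
qed

lemma integrable_rho:
  assumes "M \<in> probs \<Omega>" "N \<in> probs \<Omega>" "\<phi> \<in> bborel" "\<psi> \<in> bborel" "\<xi> \<in> bborel"
  shows "integrable (M \<Otimes>\<^sub>M N) (\<lambda>(x, y). rho \<phi> \<psi> x y * \<xi> x)"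
proof -
  interpret M: prob_space M using assms by (simp add: probs_def)
  interpret N: prob_space N using assms by (simp add: probs_def)
  interpret pair_prob_space M N ..
  obtain b where b: "\<And>x y. rho \<phi> \<psi> x y \<le> b" using rho_bound assms by blast
  obtain k where k: "\<And>x. \<bar>\<xi> x\<bar> \<le> k" "0 \<le> k" using bborelE assms by blast
  have "\<xi> \<in> borel_measurable M"
    using prob_integrable[OF assms(1,5)] by (rule borel_measurable_integrable)
  then have [measurable]: "(\<lambda>z. \<xi> (fst z)) \<in> borel_measurable (M \<Otimes>\<^sub>M N)" by measurable
  note [measurable] = measurable_rho[OF assms(1-4)]
  show ?thesis
  proof (rule P.integrable_const_bound[of _ "b * k"])
    have "norm (rho \<phi> \<psi> x y * \<xi> x) \<le> b * k" for x y
      unfolding norm_mult using b[of x y] k rho_pos[of \<phi> \<psi> x y] by (intro mult_mono) auto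
    then show "AE z in M \<Otimes>\<^sub>M N. norm (case z of (x, y) \<Rightarrow> rho \<phi> \<psi> x y * \<xi> x) \<le> b * k" by auto
    have "(\<lambda>z. case_prod (rho \<phi> \<psi>) z * \<xi> (fst z)) \<in> borel_measurable (M \<Otimes>\<^sub>M N)" by measurable
    then show "(\<lambda>(x, y). rho \<phi> \<psi> x y * \<xi> x) \<in> borel_measurable (M \<Otimes>\<^sub>M N)"
      by (simp add: case_prod_beta')
  qed
qed

text \<open>The soft transform is the normalisation of the Gibbs density in its first variable. One
  marginal is thus right for every \<phi>, and optimality has to deliver the other.\<close>

lemma rho_soft:
  assumes "M \<in> probs \<Omega>" "\<phi> \<in> bborel"
  shows "(\<integral>x. rho \<phi> (soft e M \<phi>) x y \<partial>M) = 1"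
proof -
  have "rho \<phi> (soft e M \<phi>) x y = exp (soft e M \<phi> y / e) * exp ((\<phi> x - c x y) / e)" for x
    by (simp add: rho_def flip: exp_add) (simp add: add_divide_distrib diff_divide_distrib)
  then show ?thesis using exp_soft[OF assms, of y] by simp
qed

text \<open>Half a Sinkhorn sweep. The pointwise loss is \<open>e\<close> times the logarithm of the
  \<open>N\<close>-integral of the Gibbs density, at most \<open>e\<close> times that integral minus
  1; integrated over \<open>M\<close> this bound is zero by Fubini and
  \<open>rho_soft\<close>.\<close>

lemma soft_improve:
  assumes M: "M \<in> probs \<Omega>" and N: "N \<in> probs \<Omega>" and phi: "\<phi> \<in> bborel"
  shows "(\<integral>x. \<phi> x \<partial>M) \<le> (\<integral>x. soft e N (soft e M \<phi>) x \<partial>M)"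
proof -
  interpret M: prob_space M using M by (simp add: probs_def)
  interpret N: prob_space N using N by (simp add: probs_def)
  interpret pair_prob_space M N ..
  define \<psi> where "\<psi> = soft e M \<phi>"
  have psi: "\<psi> \<in> bborel" using soft_bborel[OF M phi] by (simp add: \<psi>_def)
  have int: "integrable (M \<Otimes>\<^sub>M N) (case_prod (rho \<phi> \<psi>))"
    using integrable_rho[OF M N phi psi bborel_const[of 1]] by simp
  have "(\<integral>x. (\<integral>y. rho \<phi> \<psi> x y \<partial>N) \<partial>M) = (\<integral>y. (\<integral>x. rho \<phi> \<psi> x y \<partial>M) \<partial>N)"
    using Fubini_integral[OF int] by simp
  also have "\<dots> = 1" using rho_soft[OF M phi] by (simp add: \<psi>_def N.prob_space)
  finally have tot: "(\<integral>x. (\<integral>y. rho \<phi> \<psi> x y \<partial>N) \<partial>M) = 1" .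
  have int2: "integrable M (\<lambda>x. \<integral>y. rho \<phi> \<psi> x y \<partial>N)" using integrable_fst[OF int] .
  have pt: "\<phi> x - soft e N \<psi> x \<le> e * ((\<integral>y. rho \<phi> \<psi> x y \<partial>N) - 1)" for x
  proof -
    let ?W = "\<integral>y. exp ((\<psi> y - c y x) / e) \<partial>N"
    have W: "0 < ?W" by (rule partition_pos[OF N psi])
    have "rho \<phi> \<psi> x y = exp (\<phi> x / e) * exp ((\<psi> y - c y x) / e)" for y
      by (simp add: rho_def c_sym[of x] flip: exp_add) (simp add: add_divide_distrib diff_divide_distrib)
    then have eq: "(\<integral>y. rho \<phi> \<psi> x y \<partial>N) = exp (\<phi> x / e) * ?W" by simp
    have "\<phi> x - soft e N \<psi> x = e * ln (exp (\<phi> x / e) * ?W)"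
      using W e_pos by (simp add: soft_def ln_mult algebra_simps)
    also have "\<dots> \<le> e * (exp (\<phi> x / e) * ?W - 1)"
      using W e_pos by (intro mult_left_mono ln_le_minus_one) auto
    finally show ?thesis by (simp add: eq)
  qed
  have "(\<integral>x. \<phi> x \<partial>M) - (\<integral>x. soft e N \<psi> x \<partial>M) = (\<integral>x. \<phi> x - soft e N \<psi> x \<partial>M)"
    by (intro Bochner_Integration.integral_diff[symmetric] prob_integrable[OF M] phi soft_bborel[OF N] psi)
  also have "\<dots> \<le> (\<integral>x. e * ((\<integral>y. rho \<phi> \<psi> x y \<partial>N) - 1) \<partial>M)"
  proof (rule integral_mono[OF _ _ pt])
    show "integrable M (\<lambda>x. \<phi> x - soft e N \<psi> x)"
      by (intro prob_integrable[OF M] bborel_diff phi soft_bborel[OF N] psi)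
    show "integrable M (\<lambda>x. e * ((\<integral>y. rho \<phi> \<psi> x y \<partial>N) - 1))" using int2 by simp
  qed
  also have "\<dots> = e * ((\<integral>x. (\<integral>y. rho \<phi> \<psi> x y \<partial>N) \<partial>M) - 1)"
    using int2 by (simp add: M.prob_space)
  also have "\<dots> = 0" by (simp add: tot)
  finally show ?thesis by (simp add: \<psi>_def)
qed

definition J2 :: "('a \<Rightarrow> real) \<Rightarrow> real" where
  "J2 \<phi> = (\<integral>x. \<phi> x \<partial>\<mu>) + (\<integral>y. soft e \<mu> \<phi> y \<partial>\<nu>)"

lemma J2_improve:
  assumes "\<phi> \<in> bborel"
  shows "J2 \<phi> \<le> J2 (soft e \<nu> (soft e \<mu> \<phi>))"
  unfolding J2_def
  using soft_improve[OF mu nu assms] soft_improve[OF nu mu soft_bborel[OF mu assms]] by (rule add_mono)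

text \<open>A full sweep improves any competitor and gives it Lipschitz constant \<open>L\<close>
  and oscillation at most \<open>R\<close>. Since subtracting a constant costs nothing, maximising
  over \<open>lip_class (-R) R\<close> suffices.\<close>

lemma J2_attained:
  "\<exists>\<phi>\<in>bborel. L-lipschitz_on \<Omega> \<phi> \<and> (\<forall>\<xi>\<in>bborel. J2 \<xi> \<le> J2 \<phi>)"
proof -
  interpret mu: prob_space \<mu> using mu by (simp add: probs_def)
  interpret nu: prob_space \<nu> using nu by (simp add: probs_def)
  have "(\<lambda>x. 0) \<in> lip_class (-R) R"
    using R_nonneg L_nonneg by (auto simp: lip_class_def bborel_const lipschitz_on_def)
  moreover have "\<bar>J2 \<phi> - J2 \<psi>\<bar> \<le> 2 * d"
    if "\<phi> \<in> lip_class (-R) R" "\<psi> \<in> lip_class (-R) R" and d: "\<And>x. x \<in> \<Omega> \<Longrightarrow> \<bar>\<phi> x - \<psi> x\<bar> \<le> d" for \<phi> \<psi> d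
  proof -
    have b: "\<phi> \<in> bborel" "\<psi> \<in> bborel" using that by (auto simp: lip_class_def)
    have "\<bar>soft e \<mu> \<phi> y - soft e \<mu> \<psi> y\<bar> \<le> d" for y
    proof -
      have "soft e \<mu> \<phi> y \<le> soft e \<mu> \<psi> y + d"
        using d by (intro soft_compare mu b) (smt (verit, best))
      moreover have "soft e \<mu> \<psi> y \<le> soft e \<mu> \<phi> y + d"
        using d by (intro soft_compare mu b) (smt (verit, best))
      ultimately show ?thesis by simp
    qed
    then have "\<bar>(\<integral>y. soft e \<mu> \<phi> y \<partial>\<nu>) - (\<integral>y. soft e \<mu> \<psi> y \<partial>\<nu>)\<bar> \<le> d"
      by (intro integral_diff_abs_le nu soft_bborel mu b)
    moreover have "\<bar>(\<integral>x. \<phi> x \<partial>\<mu>) - (\<integral>x. \<psi> x \<partial>\<mu>)\<bar> \<le> d"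
      by (intro integral_diff_abs_le mu b d)
    ultimately show ?thesis unfolding J2_def by linarith
  qed
  ultimately obtain \<phi> where phi: "\<phi> \<in> lip_class (-R) R"
    and max: "\<And>\<xi>. \<xi> \<in> lip_class (-R) R \<Longrightarrow> J2 \<xi> \<le> J2 \<phi>"
    using lip_class_attains_max[of "-R" R J2 2] by blast
  have "J2 \<xi> \<le> J2 \<phi>" if chi: "\<xi> \<in> bborel" for \<xi>
  proof -
    define \<eta> where "\<eta> = soft e \<nu> (soft e \<mu> \<xi>)"
    have b: "soft e \<mu> \<xi> \<in> bborel" "\<eta> \<in> bborel"
      unfolding \<eta>_def by (intro soft_bborel mu nu chi)+
    \<comment> \<open>\<open>0\<close> is the origin, possibly outside \<Omega>; this is harmless
      because the oscillation bound holds on the whole space.\<close>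
    define a where "a = \<eta> 0"
    have b': "(\<lambda>x. \<eta> x - a) \<in> bborel" by (intro bborel_diff b bborel_const)
    have "(\<lambda>x. \<eta> x - a) \<in> lip_class (-R) R"
      using soft_lip[OF nu b(1)] soft_osc[OF nu b(1), of _ 0] b' L_nonneg
      by (auto simp: lip_class_def lipschitz_on_def dist_real_def \<eta>_def a_def abs_le_iff algebra_simps)
    then have "J2 (\<lambda>x. \<eta> x - a) \<le> J2 \<phi>" by (rule max)
    moreover have "J2 \<eta> \<le> J2 (\<lambda>x. \<eta> x - a)"
    proof -
      have "(\<integral>y. soft e \<mu> \<eta> y + a \<partial>\<nu>) \<le> (\<integral>y. soft e \<mu> (\<lambda>x. \<eta> x - a) y \<partial>\<nu>)"
      proof (rule integral_mono)
        fix y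
        show "soft e \<mu> \<eta> y + a \<le> soft e \<mu> (\<lambda>x. \<eta> x - a) y"
          using soft_compare[OF mu b(2) b', of y y "-a"] by simp
      qed (intro prob_integrable[OF nu] bborel_add bborel_const soft_bborel mu b b')+
      then show ?thesis unfolding J2_def
        using prob_integrable[OF mu b(2)] prob_integrable[OF nu soft_bborel[OF mu b(2)]]
        by (simp add: mu.prob_space nu.prob_space)
    qed
    ultimately show ?thesis using J2_improve[OF chi] by (simp add: \<eta>_def)
  qed
  then show ?thesis using phi by (auto simp: lip_class_def)
qed

text \<open>The plan is the Gibbs density at the maximiser: its second marginal is right by
  \<open>rho_soft\<close>, its first by optimality in indicator directions, and nonnegativity of its
  relative entropy bounds the cost. The Lipschitz bound on \<phi> is exported for the limit of small
  \<open>e\<close>.\<close>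

lemma entropic_plan:
  "\<exists>\<phi>\<in>bborel. L-lipschitz_on \<Omega> \<phi> \<and> (\<exists>\<gamma>\<in>plans \<mu> \<nu>.
     (\<integral>z. case_prod c z \<partial>\<gamma>) \<le> (\<integral>x. \<phi> x \<partial>\<mu>) + (\<integral>y. soft e \<mu> \<phi> y \<partial>\<nu>))"
proof -
  interpret M: prob_space \<mu> using mu by (simp add: probs_def)
  interpret N: prob_space \<nu> using nu by (simp add: probs_def)
  interpret pair_prob_space \<mu> \<nu> ..
  let ?P = "\<mu> \<Otimes>\<^sub>M \<nu>"
  have s1: "sets \<mu> = sets borel" and s2: "sets \<nu> = sets borel" using mu nu by (auto simp: probs_def)
  have sp1: "space \<mu> = UNIV" and sp2: "space \<nu> = UNIV"
    using sets_eq_imp_space_eq[OF s1] sets_eq_imp_space_eq[OF s2] by simp_all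
  have sP: "sets ?P = sets (borel \<Otimes>\<^sub>M borel)" using s1 s2 by (intro sets_pair_measure_cong)
  obtain \<phi> where phi: "\<phi> \<in> bborel" and lip: "L-lipschitz_on \<Omega> \<phi>"
    and max: "\<And>\<xi>. \<xi> \<in> bborel \<Longrightarrow> J2 \<xi> \<le> J2 \<phi>" using J2_attained by blast
  define \<psi> where "\<psi> = soft e \<mu> \<phi>"
  have psi: "\<psi> \<in> bborel" unfolding \<psi>_def by (rule soft_bborel[OF mu phi])
  define r where "r = case_prod (rho \<phi> \<psi>)"
  have rm [measurable]: "r \<in> borel_measurable ?P" unfolding r_def by (rule measurable_rho[OF mu nu phi psi])
  have r0: "0 < r z" for z by (simp add: r_def rho_pos case_prod_beta')
  have rint: "integrable ?P (\<lambda>(x, y). rho \<phi> \<psi> x y * \<xi> x)" if "\<xi> \<in> bborel" for \<xi>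
    by (rule integrable_rho[OF mu nu phi psi that])
  have int: "integrable ?P r" using rint[OF bborel_const[of 1]] by (simp add: r_def)
  have rho1: "(\<integral>x. rho \<phi> \<psi> x y \<partial>\<mu>) = 1" for y unfolding \<psi>_def by (rule rho_soft[OF mu phi])
  have tot: "(\<integral>z. r z \<partial>?P) = 1"
    using integral_snd[OF int[unfolded r_def]] by (simp add: rho1 N.prob_space r_def)
  define \<gamma> where "\<gamma> = density ?P (\<lambda>z. ennreal (r z))"
  have sets\<gamma>: "sets \<gamma> = sets (borel \<Otimes>\<^sub>M borel)" by (simp add: \<gamma>_def sP)
  have space\<gamma>: "space \<gamma> = UNIV" by (simp add: \<gamma>_def space_pair_measure sp1 sp2)
  have G: "prob_space \<gamma>"
  proof
    have "emeasure \<gamma> (space \<gamma>) = (\<integral>\<^sup>+z. ennreal (r z) \<partial>?P)"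
      by (simp add: \<gamma>_def emeasure_density cong: nn_integral_cong)
    also have "\<dots> = 1" using nn_integral_eq_integral[OF int] r0 tot by (simp add: less_imp_le)
    finally show "emeasure \<gamma> (space \<gamma>) = 1" .
  qed
  interpret G: prob_space \<gamma> by (rule G)
  have mfst: "fst \<in> \<gamma> \<rightarrow>\<^sub>M borel" and msnd: "snd \<in> \<gamma> \<rightarrow>\<^sub>M borel"
    using measurable_cong_sets[OF sets\<gamma> refl, of borel] by auto
  interpret D1: prob_space "distr \<gamma> borel fst" by (rule G.prob_space_distr[OF mfst])
  interpret D2: prob_space "distr \<gamma> borel snd" by (rule G.prob_space_distr[OF msnd])
  have meas\<gamma>: "measure \<gamma> A = (\<integral>z. r z * indicator A z \<partial>?P)" if "A \<in> sets ?P" for A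
  proof -
    have i: "integrable ?P (\<lambda>z. r z * indicator A z)"
      using int that by (intro integrable_real_mult_indicator)
    have "emeasure \<gamma> A = (\<integral>\<^sup>+z. ennreal (r z * indicator A z) \<partial>?P)"
      unfolding \<gamma>_def using that by (simp add: emeasure_density) (auto intro!: nn_integral_cong simp: indicator_def)
    also have "\<dots> = ennreal (\<integral>z. r z * indicator A z \<partial>?P)"
      using i r0 by (intro nn_integral_eq_integral) (auto simp: less_imp_le)
    finally show ?thesis using r0 by (simp add: measure_def less_imp_le integral_nonneg)
  qed
  \<comment> \<open>Raising \<phi> by \<open>e * s\<close> on \<open>B\<close> cannot raise
    \<open>J2\<close>; divided by \<open>s\<close>, as \<open>s\<close> tends to 0, this bounds
    \<open>measure \<mu> B\<close> by the mass of the plan over \<open>B\<close>.\<close>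
  have "\<mu> = distr \<gamma> borel fst"
  proof (rule prob_measure_eqI_le)
    show "prob_space \<mu>" "prob_space (distr \<gamma> borel fst)" by unfold_locales
    show "sets \<mu> = sets (distr \<gamma> borel fst)" by (simp add: s1)
    fix B assume "B \<in> sets \<mu>"
    then have B: "B \<in> sets borel" by (simp add: s1)
    then have B': "indicat_real B \<in> bborel" by (rule bborel_indicator)
    let ?m = "\<integral>z. (case z of (x, y) \<Rightarrow> rho \<phi> \<psi> x y * indicator B x) \<partial>?P"
    have m_eq: "measure (distr \<gamma> borel fst) B = ?m"
    proof -
      have A: "B \<times> UNIV \<in> sets ?P" using B by (simp add: s1 s2)
      have "measure (distr \<gamma> borel fst) B = measure \<gamma> (B \<times> UNIV)"
        using B mfst by (simp add: measure_distr space\<gamma>) (simp add: vimage_fst)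
      also have "\<dots> = ?m" unfolding meas\<gamma>[OF A]
        by (rule Bochner_Integration.integral_cong) (auto simp: r_def indicator_def)
      finally show ?thesis .
    qed
    have key: "s * measure \<mu> B \<le> (exp s - 1) * ?m" if s: "0 < s" for s
    proof -
      define \<xi> where "\<xi> x = \<phi> x + e * s * indicator B x" for x
      have xi: "\<xi> \<in> bborel" unfolding \<xi>_def by (intro bborel_add phi bborel_cmult B')
      \<comment> \<open>This is \<open>exp (s * indicator B x)\<close> written affinely in the
        indicator, so that the perturbed total mass involves \<open>B\<close> only through
        \<open>?m\<close>.\<close>
      define w where "w x = 1 + (exp s - 1) * indicat_real B x" for x
      have w: "w \<in> bborel" unfolding w_def by (intro bborel_add bborel_const bborel_cmult B')
      note wint = rint[OF w]
      have pt: "\<psi> y - soft e \<mu> \<xi> y \<le> e * ((\<integral>x. rho \<phi> \<psi> x y * w x \<partial>\<mu>) - 1)" for y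
      proof -
        let ?Z = "\<integral>x. exp ((\<xi> x - c x y) / e) \<partial>\<mu>"
        have Z: "0 < ?Z" by (rule partition_pos[OF mu xi])
        have "rho \<phi> \<psi> x y * w x = exp (\<psi> y / e) * exp ((\<xi> x - c x y) / e)" for x
        proof -
          have "w x = exp (s * indicator B x)" by (auto simp: w_def indicator_def)
          then show ?thesis using e_pos
            by (simp add: rho_def \<xi>_def flip: exp_add) (simp add: add_divide_distrib diff_divide_distrib)
        qed
        then have eq: "(\<integral>x. rho \<phi> \<psi> x y * w x \<partial>\<mu>) = exp (\<psi> y / e) * ?Z" by simp
        have "\<psi> y - soft e \<mu> \<xi> y = e * ln (exp (\<psi> y / e) * ?Z)"
          using Z e_pos by (simp add: soft_def ln_mult algebra_simps)
        also have "\<dots> \<le> e * (exp (\<psi> y / e) * ?Z - 1)"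
          using Z e_pos by (intro mult_left_mono ln_le_minus_one) auto
        finally show ?thesis by (simp add: eq)
      qed
      have int2: "integrable \<nu> (\<lambda>y. \<integral>x. rho \<phi> \<psi> x y * w x \<partial>\<mu>)" by (rule integrable_snd[OF wint])
      have "(\<integral>y. \<psi> y \<partial>\<nu>) - (\<integral>y. soft e \<mu> \<xi> y \<partial>\<nu>) = (\<integral>y. \<psi> y - soft e \<mu> \<xi> y \<partial>\<nu>)"
        by (intro Bochner_Integration.integral_diff[symmetric] prob_integrable[OF nu] psi soft_bborel[OF mu] xi)
      also have "\<dots> \<le> (\<integral>y. e * ((\<integral>x. rho \<phi> \<psi> x y * w x \<partial>\<mu>) - 1) \<partial>\<nu>)"
      proof (rule integral_mono[OF _ _ pt])
        show "integrable \<nu> (\<lambda>y. \<psi> y - soft e \<mu> \<xi> y)"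
          by (intro prob_integrable[OF nu] bborel_diff psi soft_bborel[OF mu] xi)
        show "integrable \<nu> (\<lambda>y. e * ((\<integral>x. rho \<phi> \<psi> x y * w x \<partial>\<mu>) - 1))" using int2 by simp
      qed
      also have "\<dots> = e * ((\<integral>y. (\<integral>x. rho \<phi> \<psi> x y * w x \<partial>\<mu>) \<partial>\<nu>) - 1)"
        using int2 by (simp add: N.prob_space)
      also have "(\<integral>y. (\<integral>x. rho \<phi> \<psi> x y * w x \<partial>\<mu>) \<partial>\<nu>) = (\<integral>z. (case z of (x, y) \<Rightarrow> rho \<phi> \<psi> x y * w x) \<partial>?P)"
        by (rule integral_snd[OF wint])
      also have "\<dots> = (\<integral>z. r z + (exp s - 1) * (case z of (x, y) \<Rightarrow> rho \<phi> \<psi> x y * indicator B x) \<partial>?P)"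
        by (rule Bochner_Integration.integral_cong) (auto simp: r_def w_def algebra_simps)
      also have "\<dots> = 1 + (exp s - 1) * ?m"
        using int rint[OF B'] by (simp add: tot)
      finally have "(\<integral>y. \<psi> y \<partial>\<nu>) - (\<integral>y. soft e \<mu> \<xi> y \<partial>\<nu>) \<le> e * ((exp s - 1) * ?m)" by simp
      moreover have "J2 \<xi> \<le> J2 \<phi>" by (rule max[OF xi])
      moreover have "(\<integral>x. \<xi> x \<partial>\<mu>) = (\<integral>x. \<phi> x \<partial>\<mu>) + e * s * measure \<mu> B"
        using prob_integrable[OF mu phi] prob_integrable[OF mu B'] B s1
        unfolding \<xi>_def by (subst Bochner_Integration.integral_add) (auto simp: sp1)
      ultimately have "e * (s * measure \<mu> B) \<le> e * ((exp s - 1) * ?m)"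
        unfolding J2_def \<psi>_def[symmetric] by simp
      then show ?thesis using e_pos by simp
    qed
    have "measure \<mu> B \<le> ?m"
    proof (rule field_le_epsilon)
      fix t :: real assume t: "0 < t"
      \<comment> \<open>Capped at 1 for the bound \<open>exp s \<le> 1 + s + s\<^sup>2\<close>;
        since \<open>?m \<le> 1\<close>, the error left after division by \<open>s\<close> is at
        most \<open>s\<close>.\<close>
      define s where "s = min t 1"
      have s: "0 < s" "s \<le> 1" "s \<le> t" using t by (auto simp: s_def)
      have m: "0 \<le> ?m" "?m \<le> 1" unfolding m_eq[symmetric] by auto
      have "s * measure \<mu> B \<le> (exp s - 1) * ?m" by (rule key[OF s(1)])
      also have "\<dots> \<le> (s + s\<^sup>2) * ?m" using exp_bound[of s] s m by (intro mult_right_mono) auto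
      also have "\<dots> = s * ((1 + s) * ?m)" by (simp add: power2_eq_square algebra_simps)
      finally have "measure \<mu> B \<le> (1 + s) * ?m" using s by simp
      also have "\<dots> \<le> ?m + s" using m s mult_left_le[of ?m s] by (simp add: algebra_simps)
      finally show "measure \<mu> B \<le> ?m + t" using s by simp
    qed
    then show "measure \<mu> B \<le> measure (distr \<gamma> borel fst) B" by (simp add: m_eq)
  qed
  moreover have "\<nu> = distr \<gamma> borel snd"
  proof (rule prob_measure_eqI_le)
    show "prob_space \<nu>" "prob_space (distr \<gamma> borel snd)" by unfold_locales
    show "sets \<nu> = sets (distr \<gamma> borel snd)" by (simp add: s2)
    fix B assume "B \<in> sets \<nu>"
    then have B: "B \<in> sets borel" by (simp add: s2)
    have A: "UNIV \<times> B \<in> sets ?P" using B by (simp add: s1 s2)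
    have i: "integrable ?P (\<lambda>(x, y). rho \<phi> \<psi> x y * indicator B y)"
    proof -
      have "integrable ?P (\<lambda>z. r z * indicator (UNIV \<times> B) z)"
        by (intro integrable_real_mult_indicator A int)
      then show ?thesis
        by (rule Bochner_Integration.integrable_cong[THEN iffD1, rotated -1]) (auto simp: r_def indicator_def)
    qed
    have "measure (distr \<gamma> borel snd) B = measure \<gamma> (UNIV \<times> B)"
      using B msnd by (simp add: measure_distr space\<gamma>) (simp add: vimage_snd)
    also have "\<dots> = (\<integral>z. (case z of (x, y) \<Rightarrow> rho \<phi> \<psi> x y * indicator B y) \<partial>?P)" unfolding meas\<gamma>[OF A]
      by (rule Bochner_Integration.integral_cong) (auto simp: r_def indicator_def)
    also have "\<dots> = (\<integral>y. (\<integral>x. rho \<phi> \<psi> x y * indicator B y \<partial>\<mu>) \<partial>\<nu>)"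
      by (rule integral_snd[OF i, symmetric])
    also have "\<dots> = measure \<nu> B" using B s2 by (simp add: rho1 sp2)
    finally show "measure \<nu> B \<le> measure (distr \<gamma> borel snd) B" by simp
  qed
  ultimately have plan: "\<gamma> \<in> plans \<mu> \<nu>" unfolding plans_def using sets\<gamma> G by auto
  have phi\<gamma>: "integrable \<gamma> (\<lambda>z. \<phi> (fst z))" "(\<integral>z. \<phi> (fst z) \<partial>\<gamma>) = (\<integral>x. \<phi> x \<partial>\<mu>)"
    using \<open>\<mu> = distr \<gamma> borel fst\<close> integrable_distr_eq[OF mfst bborel_measurable[OF phi]]
      integral_distr[OF mfst bborel_measurable[OF phi]] prob_integrable[OF mu phi] by auto
  have psi\<gamma>: "integrable \<gamma> (\<lambda>z. \<psi> (snd z))" "(\<integral>z. \<psi> (snd z) \<partial>\<gamma>) = (\<integral>x. \<psi> x \<partial>\<nu>)"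
    using \<open>\<nu> = distr \<gamma> borel snd\<close> integrable_distr_eq[OF msnd bborel_measurable[OF psi]]
      integral_distr[OF msnd bborel_measurable[OF psi]] prob_integrable[OF nu psi] by auto
  have c\<gamma>: "integrable \<gamma> (case_prod c)"
    using c_measurable measurable_cong_sets[OF sets\<gamma> refl, of borel]
    by (intro G.integrable_const_bound[of _ R]) (auto simp: c_nonneg c_le)
  have inv: "integrable \<gamma> (\<lambda>z. 1 / r z)" "(\<integral>z. 1 / r z \<partial>\<gamma>) = 1"
  proof -
    have eq: "r z *\<^sub>R (1 / r z) = 1" for z using r0[of z] by simp
    have "integrable ?P (\<lambda>z. r z *\<^sub>R (1 / r z))" "(\<integral>z. r z *\<^sub>R (1 / r z) \<partial>?P) = 1"
      unfolding eq by (auto simp: P.prob_space)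
    then show "integrable \<gamma> (\<lambda>z. 1 / r z)" "(\<integral>z. 1 / r z \<partial>\<gamma>) = 1"
      unfolding \<gamma>_def using r0 by (auto simp: integrable_density integral_density less_imp_le)
  qed
  \<comment> \<open>The right integrand is \<open>e * ln (r z)\<close>, whose integral is
    \<open>e\<close> times the relative entropy of the plan. The lower bound
    \<open>1 - 1 / r z\<close> of the logarithm has integral 0, so that entropy is
    nonnegative.\<close>
  have "(\<integral>z. e * (1 - 1 / r z) \<partial>\<gamma>) \<le> (\<integral>z. \<phi> (fst z) + \<psi> (snd z) - case_prod c z \<partial>\<gamma>)"
  proof (rule integral_mono)
    fix z
    have "e * (1 - 1 / r z) \<le> e * ln (r z)"
      using ln_le_minus_one[of "1 / r z"] r0[of z] e_pos by (intro mult_left_mono) (auto simp: ln_div)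
    then show "e * (1 - 1 / r z) \<le> \<phi> (fst z) + \<psi> (snd z) - case_prod c z"
      using e_pos by (simp add: r_def rho_def case_prod_beta')
  qed (use phi\<gamma>(1) psi\<gamma>(1) c\<gamma> inv(1) in auto)
  then have "0 \<le> (\<integral>x. \<phi> x \<partial>\<mu>) + (\<integral>x. \<psi> x \<partial>\<nu>) - (\<integral>z. case_prod c z \<partial>\<gamma>)"
    using phi\<gamma> psi\<gamma> c\<gamma> inv by (simp add: G.prob_space)
  then show ?thesis using phi lip plan unfolding \<psi>_def by (intro bexI[OF _ phi] conjI bexI[OF _ plan]) auto
qed

end

section \<open>Removing the regularisation\<close>

context lipschitz_cost
begin

text \<open>For small \<open>e\<close> the soft transform exceeds the transform of a slightly
  modified potential by at most \<open>t\<close>, so the entropic plan costs at most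
  \<open>t\<close> more than an admissible dual value.\<close>

lemma kantorovich_duality:
  assumes mu: "\<mu> \<in> probs \<Omega>" and nu: "\<nu> \<in> probs \<Omega>"
    and dual: "\<And>\<phi>. \<phi> \<in> bborel \<Longrightarrow> (\<integral>x. \<phi> x \<partial>\<mu>) + (\<integral>y. ct \<phi> y \<partial>\<nu>) \<le> A" and "0 < t"
  shows "\<exists>\<gamma>\<in>plans \<mu> \<nu>. (\<integral>z. case_prod c z \<partial>\<gamma>) \<le> A + t"
proof -
  interpret M: prob_space \<mu> using mu by (simp add: probs_def)
  interpret N: prob_space \<nu> using nu by (simp add: probs_def)
  have s1: "sets \<mu> = sets borel" and s2: "sets \<nu> = sets borel" using mu nu by (auto simp: probs_def)
  \<comment> \<open>Points of a \<delta>-ball are within \<open>2 * \<delta>\<close> of each other,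
    so \<phi> and \<open>c\<close> each move by at most \<open>2 * L * \<delta>\<close>; together
    they may use half of the error \<open>t\<close>.\<close>
  define \<delta> where "\<delta> = t / (8 * (L + 1))"
  have d: "0 < \<delta>" "4 * L * \<delta> \<le> t / 2"
    using \<open>0 < t\<close> L_nonneg by (auto simp: \<delta>_def field_simps)
  obtain X where X: "finite X" "\<Omega> \<subseteq> (\<Union>x\<in>X. ball x \<delta>)"
    using compact_dom d(1) unfolding compact_eq_totally_bounded by blast
  \<comment> \<open>Off the null set \<open>N0\<close>, the balls carry mass at least \<open>m\<close>, so that for
    \<open>e \<ll> 1 / \<bar>ln m\<bar>\<close> the soft minimum is close to the minimum.\<close>
  define X0 where "X0 = {x \<in> X. measure \<mu> (ball x \<delta>) = 0}"
  define N0 where "N0 = (\<Union>x\<in>X0. ball x \<delta>)"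
  \<comment> \<open>The extra 1 makes the set nonempty at once and ensures
    \<open>ln m \<le> 0\<close>.\<close>
  define m where "m = Min (insert 1 ((\<lambda>x. measure \<mu> (ball x \<delta>)) ` (X - X0)))"
  have m0: "0 < m" using X(1) by (auto simp: m_def X0_def zero_less_measure_iff)
  have m1: "m \<le> 1" using X(1) by (simp add: m_def)
  have m: "m \<le> measure \<mu> (ball x \<delta>)" if "x \<in> X - X0" for x using X(1) that by (simp add: m_def)
  have N0: "AE x in \<mu>. x \<notin> N0"
  proof -
    have "AE x in \<mu>. \<forall>z\<in>X0. x \<notin> ball z \<delta>"
    proof (rule AE_finite_allI)
      show "finite X0" using X(1) by (simp add: X0_def)
      fix z assume "z \<in> X0"
      then have "ball z \<delta> \<in> null_sets \<mu>"
        by (intro null_setsI) (auto simp: X0_def M.emeasure_eq_measure s1)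
      then show "AE x in \<mu>. x \<notin> ball z \<delta>" by (rule AE_not_in)
    qed
    then show ?thesis by (auto simp: N0_def)
  qed
  \<comment> \<open>The other half of \<open>t\<close> pays for \<open>- e * ln m\<close>; the
    denominator is positive also when \<open>m = 1\<close>.\<close>
  define e where "e = t / (2 * (1 - ln m))"
  have ln: "0 < 1 - ln m" using m0 m1 ln_le_zero_iff[of m] by linarith
  have e: "0 < e" "- e * ln m \<le> t / 2"
  proof -
    show "0 < e" using \<open>0 < t\<close> ln by (simp add: e_def)
    have "- e * ln m \<le> e * (1 - ln m)" using \<open>0 < e\<close> by (simp add: algebra_simps)
    also have "\<dots> = t / 2" using ln unfolding e_def by (metis mult.commute nonzero_eq_divide_eq divide_divide_eq_left less_irrefl)
    finally show "- e * ln m \<le> t / 2" .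
  qed
  interpret entropic \<Omega> c L R e \<mu> \<nu> by unfold_locales (use e mu nu in auto)
  obtain \<phi> \<gamma> where phi: "\<phi> \<in> bborel" and lip: "L-lipschitz_on \<Omega> \<phi>" and plan: "\<gamma> \<in> plans \<mu> \<nu>"
    and cost: "(\<integral>z. case_prod c z \<partial>\<gamma>) \<le> (\<integral>x. \<phi> x \<partial>\<mu>) + (\<integral>y. soft e \<mu> \<phi> y \<partial>\<nu>)"
    using entropic_plan by blast
  have psi: "soft e \<mu> \<phi> \<in> bborel" by (rule soft_bborel[OF mu phi])
  \<comment> \<open>On a charged ball containing \<open>x\<close> the integrand stays almost
    everywhere above \<open>?k\<close>, so the integral is at least \<open>?k * m\<close>;
    logarithms turn the factor \<open>m\<close> into the error \<open>- e * ln m\<close>.\<close>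
  have near: "soft e \<mu> \<phi> y - t \<le> c x y - \<phi> x" if x: "x \<in> \<Omega>" "x \<notin> N0" for x y
  proof -
    obtain z where z: "z \<in> X" "x \<in> ball z \<delta>" using x X(2) by blast
    then have z0: "z \<in> X - X0" using x(2) by (auto simp: N0_def)
    let ?k = "exp ((\<phi> x - c x y - 4 * L * \<delta>) / e)"
    let ?Z = "\<integral>x. exp ((\<phi> x - c x y) / e) \<partial>\<mu>"
    have "?k * m \<le> ?k * measure \<mu> (ball z \<delta>)" using m[OF z0] by (intro mult_left_mono) auto
    also have "\<dots> = (\<integral>x. ?k * indicator (ball z \<delta>) x \<partial>\<mu>)" using s1 sets_eq_imp_space_eq[OF s1] by simp
    also have "\<dots> \<le> ?Z"
    proof (rule integral_mono_AE)
      show "integrable \<mu> (\<lambda>x. ?k * indicator (ball z \<delta>) x)"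
        by (intro prob_integrable[OF mu] bborel_cmult bborel_indicator) auto
      show "integrable \<mu> (\<lambda>x. exp ((\<phi> x - c x y) / e))"
        by (intro prob_integrable[OF mu] bborel_exp_cost phi)
      show "AE w in \<mu>. ?k * indicator (ball z \<delta>) w \<le> exp ((\<phi> w - c w y) / e)"
        using probs_AE[OF mu]
      proof eventually_elim
        case (elim w)
        show ?case
        proof (cases "w \<in> ball z \<delta>")
          case True
          then have "dist x w \<le> 2 * \<delta>" using z(2) dist_triangle2[of x w z] by (simp add: dist_commute)
          then have "L * dist x w \<le> L * (2 * \<delta>)" using L_nonneg by (rule mult_left_mono)
          moreover have "\<bar>\<phi> x - \<phi> w\<bar> \<le> L * dist x w"
            using lipschitz_onD[OF lip x(1) elim] by (simp add: dist_real_def)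
          moreover have "\<bar>c x y - c w y\<bar> \<le> L * dist x w" by (rule c_lip)
          ultimately have "\<phi> x - c x y - 4 * L * \<delta> \<le> \<phi> w - c w y" by linarith
          then show ?thesis using True e(1) by (simp add: divide_right_mono)
        qed simp
      qed
    qed
    finally have "ln (?k * m) \<le> ln ?Z" using m0 by (intro ln_mono) auto
    then have "(\<phi> x - c x y - 4 * L * \<delta>) / e + ln m \<le> ln ?Z" using m0 by (simp add: ln_mult)
    then have "e * ((\<phi> x - c x y - 4 * L * \<delta>) / e + ln m) \<le> e * ln ?Z" using e(1) by (intro mult_left_mono) auto
    then have "\<phi> x - c x y - 4 * L * \<delta> + e * ln m \<le> - soft e \<mu> \<phi> y"
      using e(1) by (simp add: soft_def distrib_left)
    then show ?thesis using d(2) e(2) by simp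
  qed
  obtain b where b: "\<And>y. \<bar>soft e \<mu> \<phi> y\<bar> \<le> b" using psi bborelE by blast
  \<comment> \<open>On the null set \<open>N0\<close> the soft transform does not control \<phi>;
    the value \<open>- b\<close> makes the constraint trivial there and leaves the \<mu>-integral
    unchanged.\<close>
  define \<xi> where "\<xi> x = \<phi> x * indicator (- N0) x - b * indicator N0 x" for x
  have N0b: "N0 \<in> sets borel" unfolding N0_def by (intro borel_open open_UN) auto
  have xi: "\<xi> \<in> bborel"
    unfolding \<xi>_def using N0b
    by (intro bborel_diff bborel_mult bborel_cmult phi bborel_indicator) auto
  have "soft e \<mu> \<phi> y - t \<le> ct \<xi> y" for y
  proof (rule ct_ge)
    fix x assume x: "x \<in> \<Omega>"
    show "soft e \<mu> \<phi> y - t \<le> c x y - \<xi> x"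
    proof (cases "x \<in> N0")
      case True
      then show ?thesis using b[of y] c_nonneg[of x y] \<open>0 < t\<close> by (simp add: \<xi>_def)
    next
      case False
      then show ?thesis using near[OF x False] by (simp add: \<xi>_def)
    qed
  qed
  then have "(\<integral>y. soft e \<mu> \<phi> y - t \<partial>\<nu>) \<le> (\<integral>y. ct \<xi> y \<partial>\<nu>)"
    by (intro integral_mono prob_integrable[OF nu] bborel_diff psi bborel_const ct_bborel bborel_bdd xi)
  then have "(\<integral>y. soft e \<mu> \<phi> y \<partial>\<nu>) - t \<le> (\<integral>y. ct \<xi> y \<partial>\<nu>)"
    using prob_integrable[OF nu psi] by (simp add: N.prob_space)
  moreover have "(\<integral>x. \<xi> x \<partial>\<mu>) = (\<integral>x. \<phi> x \<partial>\<mu>)"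
  proof (intro integral_cong_AE borel_measurable_integrable prob_integrable[OF mu] xi phi)
    show "AE x in \<mu>. \<xi> x = \<phi> x" using N0 by eventually_elim (simp add: \<xi>_def)
  qed
  ultimately have "(\<integral>z. case_prod c z \<partial>\<gamma>) \<le> A + t" using dual[OF xi] cost by linarith
  then show ?thesis using plan by blast
qed

end

section \<open>The dual problem\<close>

text \<open>\<open>ennreal\<close> cuts negative numbers to 0, and the dual value in the place of
  \<open>a\<close> may be negative.\<close>

lemma ennreal_add_le_add: "0 \<le> b \<Longrightarrow> ennreal (a + b) \<le> ennreal a + ennreal b"
  by (cases "0 \<le> a") (auto simp: ennreal_plus ennreal_neg intro!: ennreal_leI)

locale energy_problem = lipschitz_cost \<Omega> c L R + internal_energy f fd
  for \<Omega> :: "'a::euclidean_space set" and c L R f fd +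
  fixes p :: real and \<nu> :: "'a measure"
  assumes c_eq: "x \<in> \<Omega> \<Longrightarrow> y \<in> \<Omega> \<Longrightarrow> c x y = dist x y powr p"
    and nu: "\<nu> \<in> probs \<Omega>" and vol_pos: "0 < measure lborel \<Omega>"
begin

sublocale nu: prob_space \<nu> using nu by (simp add: probs_def)

text \<open>A density rather than a restricted space: the Borel sets stay those of the whole space,
  so \<open>bborel\<close> functions remain measurable.\<close>

definition lam :: "'a measure" where
  "lam = density lborel (\<lambda>x. ennreal (indicat_real \<Omega> x))"

lemma dom_borel [measurable]: "\<Omega> \<in> sets borel"
  using compact_dom by (auto simp: compact_imp_closed)

lemma sets_lam [simp]: "sets lam = sets borel" and space_lam [simp]: "space lam = UNIV"
  by (simp_all add: lam_def)

lemma measurable_lam [simp]: "borel_measurable lam = borel_measurable borel"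
  by (intro measurable_cong_sets) simp_all

lemma emeasure_lam: "emeasure lam UNIV = ennreal (measure lborel \<Omega>)"
proof -
  have "emeasure lam UNIV = emeasure lborel \<Omega>"
    unfolding lam_def by (subst emeasure_density) (auto simp: ennreal_indicator)
  also have "\<dots> = ennreal (measure lborel \<Omega>)"
    using emeasure_compact_finite[OF compact_dom] by (intro emeasure_eq_ennreal_measure) auto
  finally show ?thesis .
qed

sublocale lam: finite_measure lam
  by standard (simp add: emeasure_lam)

lemma measure_lam: "measure lam UNIV = measure lborel \<Omega>"
  by (simp add: measure_def emeasure_lam)

lemma AE_lam: "(AE x in lam. P x) \<longleftrightarrow> (AE x in lborel. x \<in> \<Omega> \<longrightarrow> P x)"
  unfolding lam_def by (subst AE_density) (auto simp: indicator_def)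

lemma AE_lam_dom: "AE x in lam. x \<in> \<Omega>"
  by (simp add: AE_lam)

lemma lam_integrable: "\<phi> \<in> bborel \<Longrightarrow> integrable lam \<phi>"
  by (intro integrable_bborel lam.finite_measure_axioms) auto

lemma nu_integrable: "\<phi> \<in> bborel \<Longrightarrow> integrable \<nu> \<phi>"
  by (rule prob_integrable[OF nu])

lemma bborel_fs: "\<phi> \<in> bborel \<Longrightarrow> (\<lambda>x. fs (- \<phi> x)) \<in> bborel"
  using bborel_comp[OF bborel_uminus fs_cont] .

lemma bborel_K: "\<phi> \<in> bborel \<Longrightarrow> (\<lambda>x. K (- \<phi> x)) \<in> bborel"
  using bborel_comp[OF bborel_uminus K_cont] .

lemma bborel_ct: "\<phi> \<in> bborel \<Longrightarrow> ct \<phi> \<in> bborel"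
  by (intro ct_bborel bborel_bdd)

section \<open>The dual functional and its maximiser\<close>

definition J :: "('a \<Rightarrow> real) \<Rightarrow> real" where
  "J \<phi> = (\<integral>y. ct \<phi> y \<partial>\<nu>) - (\<integral>x. fs (- \<phi> x) \<partial>lam)"

lemma bborel_min:
  assumes "\<phi> \<in> bborel" shows "(\<lambda>x. min (\<phi> x) 0) \<in> bborel"
  by (rule bborel_comp[OF assms, of "\<lambda>t. min t 0"]) (intro continuous_intros)

lemma c_diag: "x \<in> \<Omega> \<Longrightarrow> c x x = 0"
  by (simp add: c_eq)

text \<open>Since \<open>fs\<close> vanishes on the negative half-line, cutting \<phi> at 0 leaves
  its integral unchanged and can only raise the transform. The double transform then raises the
  function, hence lowers the \<open>fs\<close> term, without lowering the transform. The sign comes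
  from the diagonal: the transform of a nonpositive function is nonnegative, and
  \<open>c x x = 0\<close>.\<close>

lemma J_improve:
  assumes phi: "\<phi> \<in> bborel"
  defines "\<psi> \<equiv> ct (ct (\<lambda>x. min (\<phi> x) 0))"
  shows "J \<phi> \<le> J \<psi>" and "\<And>x. x \<in> \<Omega> \<Longrightarrow> \<psi> x \<le> 0"
proof -
  define \<phi>' where "\<phi>' x = min (\<phi> x) 0" for x
  have phi': "\<phi>' \<in> bborel" unfolding \<phi>'_def by (rule bborel_min[OF phi])
  have psi_eq: "\<psi> = ct (ct \<phi>')" by (simp add: \<psi>_def \<phi>'_def[abs_def])
  have psi: "\<psi> \<in> bborel" unfolding psi_eq by (intro bborel_ct phi')
  have ge: "\<phi>' x \<le> \<psi> x" if "x \<in> \<Omega>" for x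
    unfolding psi_eq using that by (intro ct_ct_ge bborel_bdd phi')
  have "ct \<phi> y \<le> ct \<psi> y" if y: "y \<in> \<Omega>" for y
  proof -
    have "ct \<phi> y \<le> ct \<phi>' y" by (intro ct_antimono bborel_bdd phi) (simp add: \<phi>'_def)
    also have "\<dots> \<le> ct \<psi> y" unfolding psi_eq by (intro ct_ct_ge bborel_bdd bborel_ct phi' y)
    finally show ?thesis .
  qed
  then have "(\<integral>y. ct \<phi> y \<partial>\<nu>) \<le> (\<integral>y. ct \<psi> y \<partial>\<nu>)"
    using probs_AE[OF nu]
    by (intro integral_mono_AE nu_integrable bborel_ct phi psi) (auto elim!: eventually_mono)
  moreover have "(\<integral>x. fs (- \<psi> x) \<partial>lam) \<le> (\<integral>x. fs (- \<phi> x) \<partial>lam)"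
  proof (intro integral_mono_AE lam_integrable bborel_fs phi psi)
    show "AE x in lam. fs (- \<psi> x) \<le> fs (- \<phi> x)"
      using AE_lam_dom
    proof eventually_elim
      case (elim x)
      have "fs (- \<psi> x) \<le> fs (- \<phi>' x)" using ge[OF elim] by (intro fs_mono) simp
      also have "- \<phi>' x = max (- \<phi> x) 0" by (simp add: \<phi>'_def max_def min_def)
      finally show ?case by (simp add: fs_max)
    qed
  qed
  ultimately show "J \<phi> \<le> J \<psi>" by (simp add: J_def)
  fix x assume x: "x \<in> \<Omega>"
  have "0 \<le> ct \<phi>' x"
  proof (rule ct_ge)
    fix z show "0 \<le> c z x - \<phi>' z"
      using c_nonneg[of z x] min.cobounded2[of "\<phi> z" 0] unfolding \<phi>'_def by linarith
  qed
  moreover have "\<psi> x \<le> c x x - ct \<phi>' x"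
    unfolding psi_eq by (intro ct_le bborel_bdd bborel_ct phi' x)
  ultimately show "\<psi> x \<le> 0" using c_diag[OF x] by simp
qed

lemma J_0: "0 \<le> J (\<lambda>x. 0)"
proof -
  have "0 \<le> ct (\<lambda>x. 0) y" for y by (rule ct_ge) (simp add: c_nonneg)
  then show ?thesis by (simp add: J_def fs_0)
qed

text \<open>Young's inequality at \<open>t = 2 / measure lborel \<Omega>\<close> makes the
  \<open>fs\<close> term grow with slope 2 in \<open>- \<psi> a\<close>, against slope 1 for the
  transform term. \<open>M\<close> is the level at which the resulting upper bound changes
  sign.\<close>

lemma J_coercive:
  defines "M \<equiv> 3 * R + measure lborel \<Omega> * f (2 / measure lborel \<Omega>)"
  assumes psi: "\<psi> \<in> bborel" and osc: "\<And>x y. \<bar>\<psi> x - \<psi> y\<bar> \<le> R" and a: "a \<in> \<Omega>" "\<psi> a < - M"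
  shows "J \<psi> \<le> 0"
proof -
  let ?v = "measure lborel \<Omega>" and ?s = "\<psi> a"
  define t where "t = 2 / ?v"
  have t: "0 \<le> t" "?v * t = 2" using vol_pos by (auto simp: t_def)
  have "ct \<psi> y \<le> R - ?s" for y
    using ct_le[OF bborel_bdd[OF psi] a(1), of y] c_le[of a y] by simp
  then have 1: "(\<integral>y. ct \<psi> y \<partial>\<nu>) \<le> R - ?s"
    by (intro nu.integral_le_const nu_integrable bborel_ct psi) auto
  have pt: "(- ?s - R) * t - f t \<le> fs (- \<psi> x)" for x
  proof -
    have "(- ?s - R) * t - f t \<le> fs (- ?s - R)" using young[OF t(1), of "- ?s - R"] by simp
    also have "\<dots> \<le> fs (- \<psi> x)" using osc[of x a] by (intro fs_mono) simp
    finally show ?thesis .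
  qed
  have "(\<integral>x. (- ?s - R) * t - f t \<partial>lam) \<le> (\<integral>x. fs (- \<psi> x) \<partial>lam)"
    by (intro integral_mono pt lam_integrable bborel_fs psi bborel_const)
  then have "?v * ((- ?s - R) * t - f t) \<le> (\<integral>x. fs (- \<psi> x) \<partial>lam)" by (simp add: measure_lam)
  moreover have "?v * ((- ?s - R) * t - f t) = 2 * (- ?s - R) - ?v * f t"
    unfolding t(2)[symmetric] by (simp add: algebra_simps)
  ultimately have 2: "2 * (- ?s - R) - ?v * f t \<le> (\<integral>x. fs (- \<psi> x) \<partial>lam)" by simp
  have "J \<psi> \<le> (R - ?s) - (2 * (- ?s - R) - ?v * f t)" unfolding J_def using 1 2 by simp
  also have "\<dots> = 3 * R + ?v * f t + ?s" by simp
  also have "\<dots> \<le> 0" using a(2) by (simp add: M_def t_def)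
  finally show ?thesis .
qed

lemma J_attained:
  "\<exists>\<psi> g. bdd_above (g ` \<Omega>) \<and> \<psi> = ct g \<and> \<psi> \<in> bborel \<and> (\<forall>x\<in>\<Omega>. \<psi> x \<le> 0) \<and> (\<forall>\<xi>\<in>bborel. J \<xi> \<le> J \<psi>)"
proof -
  define M where "M = 3 * R + measure lborel \<Omega> * f (2 / measure lborel \<Omega>)"
  have M: "0 \<le> M" unfolding M_def using R_nonneg f_nonneg[of "2 / measure lborel \<Omega>"] by simp
  have z: "(\<lambda>x. 0) \<in> lip_class (-M) 0"
    using M L_nonneg by (auto simp: lip_class_def bborel_const lipschitz_on_def)
  have "\<bar>J \<phi> - J \<psi>\<bar> \<le> (1 + K M * measure lborel \<Omega>) * d"
    if "\<phi> \<in> lip_class (-M) 0" "\<psi> \<in> lip_class (-M) 0" and d: "\<And>x. x \<in> \<Omega> \<Longrightarrow> \<bar>\<phi> x - \<psi> x\<bar> \<le> d" for \<phi> \<psi> d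
  proof -
    have b: "\<phi> \<in> bborel" "\<psi> \<in> bborel" using that by (auto simp: lip_class_def)
    have 1: "\<bar>(\<integral>y. ct \<phi> y \<partial>\<nu>) - (\<integral>y. ct \<psi> y \<partial>\<nu>)\<bar> \<le> d"
      by (intro integral_diff_abs_le[OF nu] bborel_ct b ct_dist bborel_bdd d)
    have "\<bar>(\<integral>x. fs (- \<phi> x) \<partial>lam) - (\<integral>x. fs (- \<psi> x) \<partial>lam)\<bar> = \<bar>\<integral>x. fs (- \<phi> x) - fs (- \<psi> x) \<partial>lam\<bar>"
      by (subst Bochner_Integration.integral_diff) (auto intro!: lam_integrable bborel_fs b)
    also have "\<dots> \<le> (\<integral>x. \<bar>fs (- \<phi> x) - fs (- \<psi> x)\<bar> \<partial>lam)" by (rule integral_abs_bound)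
    also have "\<dots> \<le> (\<integral>x. K M * d \<partial>lam)"
    proof (rule integral_mono_AE)
      show "integrable lam (\<lambda>x. \<bar>fs (- \<phi> x) - fs (- \<psi> x)\<bar>)"
        by (intro integrable_abs lam_integrable bborel_diff bborel_fs b)
      show "AE x in lam. \<bar>fs (- \<phi> x) - fs (- \<psi> x)\<bar> \<le> K M * d"
        using AE_lam_dom
      proof eventually_elim
        case (elim x)
        then have "- \<phi> x \<le> M" "- \<psi> x \<le> M" using that(1,2) by (force simp: lip_class_def)+
        then have "\<bar>fs (- \<phi> x) - fs (- \<psi> x)\<bar> \<le> K M * \<bar>- \<phi> x - - \<psi> x\<bar>" by (rule fs_lipschitz)
        also have "\<dots> \<le> K M * d" using d[OF elim] K_nonneg by (intro mult_left_mono) auto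
        finally show ?case .
      qed
    qed simp
    finally have 2: "\<bar>(\<integral>x. fs (- \<phi> x) \<partial>lam) - (\<integral>x. fs (- \<psi> x) \<partial>lam)\<bar> \<le> K M * measure lborel \<Omega> * d"
      by (simp add: measure_lam mult_ac)
    show ?thesis using 1 2 unfolding J_def by (simp add: distrib_right)
  qed
  then obtain \<phi> where phi: "\<phi> \<in> lip_class (-M) 0"
    and max: "\<And>\<xi>. \<xi> \<in> lip_class (-M) 0 \<Longrightarrow> J \<xi> \<le> J \<phi>"
    using lip_class_attains_max[of "-M" 0 J "1 + K M * measure lborel \<Omega>"] z by blast
  have best: "J \<xi> \<le> J \<phi>" if xi: "\<xi> \<in> bborel" for \<xi>
  proof -
    define \<psi> where "\<psi> = ct (ct (\<lambda>x. min (\<xi> x) 0))"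
    have b: "bdd_above (ct (\<lambda>x. min (\<xi> x) 0) ` \<Omega>)" by (intro bborel_bdd bborel_ct bborel_min xi)
    have psi: "\<psi> \<in> bborel" unfolding \<psi>_def by (intro bborel_ct bborel_min xi)
    have le: "\<psi> x \<le> 0" if "x \<in> \<Omega>" for x unfolding \<psi>_def using J_improve(2)[OF xi that] .
    have "J \<xi> \<le> J \<psi>" unfolding \<psi>_def by (rule J_improve(1)[OF xi])
    also have "J \<psi> \<le> J \<phi>"
    \<comment> \<open>A competitor dipping below \<open>- M\<close> does no better than the zero
      function; any other lies in the class.\<close>
    proof (cases "\<exists>a\<in>\<Omega>. \<psi> a < - M")
      case True
      then obtain a where "a \<in> \<Omega>" "\<psi> a < - M" by blast
      then have "J \<psi> \<le> 0"
        using ct_osc[OF b] by (intro J_coercive[OF psi]) (auto simp: \<psi>_def M_def)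
      also have "0 \<le> J \<phi>" using J_0 max[OF z] by simp
      finally show ?thesis .
    next
      case False
      then have "\<psi> \<in> lip_class (-M) 0"
        using psi le ct_lip[OF b] L_nonneg
        by (auto simp: lip_class_def lipschitz_on_def dist_real_def \<psi>_def not_less)
      then show ?thesis by (rule max)
    qed
    finally show ?thesis .
  qed
  have phib: "\<phi> \<in> bborel" using phi by (simp add: lip_class_def)
  \<comment> \<open>A maximiser in the class need not be a transform; one more improvement makes it
    c-concave without loss.\<close>
  define g where "g = ct (\<lambda>x. min (\<phi> x) 0)"
  have "bdd_above (g ` \<Omega>)" "ct g \<in> bborel"
    unfolding g_def by (intro bborel_bdd bborel_ct bborel_min phib)+
  moreover have "\<forall>x\<in>\<Omega>. ct g x \<le> 0" "J \<phi> \<le> J (ct g)"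
    unfolding g_def using J_improve[OF phib] by auto
  ultimately show ?thesis using best order_trans by blast
qed

text \<open>Along the segment from \<psi> to \<xi> the transform term lies above its chord, so after
  division by the step its full increment remains; the \<open>fs\<close> term is differentiated. The
  inequality is therefore global in \<xi>.\<close>

lemma J_first_order:
  assumes psi: "\<psi> \<in> bborel" and max: "\<And>\<xi>. \<xi> \<in> bborel \<Longrightarrow> J \<xi> \<le> J \<psi>" and xi: "\<xi> \<in> bborel"
  shows "(\<integral>x. \<xi> x * K (- \<psi> x) \<partial>lam) + (\<integral>y. ct \<xi> y \<partial>\<nu>) \<le> (\<integral>x. \<psi> x * K (- \<psi> x) \<partial>lam) + (\<integral>y. ct \<psi> y \<partial>\<nu>)"
proof -
  define \<delta> where "\<delta> x = \<xi> x - \<psi> x" for x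
  have del: "\<delta> \<in> bborel" unfolding \<delta>_def by (intro bborel_diff psi xi)
  let ?D = "(\<integral>y. ct \<xi> y \<partial>\<nu>) - (\<integral>y. ct \<psi> y \<partial>\<nu>)"
  have step: "?D \<le> (\<integral>x. K (- (\<psi> x + t * \<delta> x)) * - \<delta> x \<partial>lam)" if t: "0 < t" "t \<le> 1" for t
  proof -
    define \<eta> where "\<eta> x = \<psi> x + t * \<delta> x" for x
    have eta: "\<eta> \<in> bborel" unfolding \<eta>_def by (intro bborel_add psi bborel_cmult del)
    have eta_eq: "\<eta> = (\<lambda>x. (1 - t) * \<psi> x + t * \<xi> x)" by (auto simp: \<eta>_def \<delta>_def algebra_simps)
    have "(1 - t) * (\<integral>y. ct \<psi> y \<partial>\<nu>) + t * (\<integral>y. ct \<xi> y \<partial>\<nu>) = (\<integral>y. (1 - t) * ct \<psi> y + t * ct \<xi> y \<partial>\<nu>)"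
      using nu_integrable[OF bborel_ct[OF psi]] nu_integrable[OF bborel_ct[OF xi]] by simp
    also have "\<dots> \<le> (\<integral>y. ct \<eta> y \<partial>\<nu>)"
    proof (rule integral_mono)
      show "(1 - t) * ct \<psi> y + t * ct \<xi> y \<le> ct \<eta> y" for y
        unfolding eta_eq using t by (intro ct_concave bborel_bdd psi xi) auto
    qed (intro nu_integrable bborel_add bborel_cmult bborel_ct psi xi eta)+
    finally have "t * ?D \<le> (\<integral>y. ct \<eta> y \<partial>\<nu>) - (\<integral>y. ct \<psi> y \<partial>\<nu>)" by (simp add: algebra_simps)
    also have "\<dots> \<le> (\<integral>x. fs (- \<eta> x) \<partial>lam) - (\<integral>x. fs (- \<psi> x) \<partial>lam)"
      using max[OF eta] by (simp add: J_def)
    also have "\<dots> = (\<integral>x. fs (- \<eta> x) - fs (- \<psi> x) \<partial>lam)"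
      by (intro Bochner_Integration.integral_diff[symmetric] lam_integrable bborel_fs eta psi)
    also have "\<dots> \<le> (\<integral>x. t * (K (- \<eta> x) * - \<delta> x) \<partial>lam)"
    proof (rule integral_mono)
      \<comment> \<open>An upper bound calls for the subgradient at the moved point
        \<open>- \<eta> x\<close>; continuity of \<open>K\<close> brings it back to
        \<open>- \<psi> x\<close> in the limit.\<close>
      show "fs (- \<eta> x) - fs (- \<psi> x) \<le> t * (K (- \<eta> x) * - \<delta> x)" for x
        using fs_subgradient[of "- \<eta> x" "- \<psi> x"] by (simp add: \<eta>_def algebra_simps)
    qed (intro lam_integrable bborel_diff bborel_fs bborel_cmult bborel_mult bborel_K bborel_uminus eta psi del)+
    also have "\<dots> = t * (\<integral>x. K (- \<eta> x) * - \<delta> x \<partial>lam)" by simp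
    finally have "?D \<le> (\<integral>x. K (- \<eta> x) * - \<delta> x \<partial>lam)" using t(1) by (simp only: mult_le_cancel_left_pos)
    then show ?thesis unfolding \<eta>_def .
  qed
  have "(\<lambda>n. \<integral>x. K (- (\<psi> x + inverse (real (Suc n)) * \<delta> x)) * - \<delta> x \<partial>lam)
      \<longlonglongrightarrow> (\<integral>x. K (- \<psi> x) * - \<delta> x \<partial>lam)"
  proof -
    obtain b where b: "\<And>x. \<bar>\<psi> x\<bar> \<le> b" using psi bborelE by blast
    obtain d where d: "\<And>x. \<bar>\<delta> x\<bar> \<le> d" "0 \<le> d" using del bborelE by blast
    have pt: "norm (K (- (\<psi> x + inverse (real (Suc n)) * \<delta> x)) * - \<delta> x) \<le> K (b + d) * d" for n x
    proof -
      have "\<bar>inverse (real (Suc n)) * \<delta> x\<bar> \<le> 1 * d"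
        unfolding abs_mult using d by (intro mult_mono) (auto simp: inverse_le_1_iff)
      then have "K (- (\<psi> x + inverse (real (Suc n)) * \<delta> x)) \<le> K (b + d)"
        using b[of x] by (intro K_mono) linarith
      then show ?thesis unfolding norm_mult using d K_nonneg by (intro mult_mono) auto
    qed
    show ?thesis
    proof (rule integral_dominated_convergence[where w="\<lambda>x. K (b + d) * d"])
      show "(\<lambda>x. K (- \<psi> x) * - \<delta> x) \<in> borel_measurable lam"
        by (intro borel_measurable_integrable lam_integrable bborel_mult bborel_K bborel_uminus psi del)
      show "(\<lambda>x. K (- (\<psi> x + inverse (real (Suc n)) * \<delta> x)) * - \<delta> x) \<in> borel_measurable lam" for n
        by (intro borel_measurable_integrable lam_integrable bborel_mult bborel_K bborel_uminus
            bborel_add bborel_cmult psi del)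
      show "AE x in lam. (\<lambda>n. K (- (\<psi> x + inverse (real (Suc n)) * \<delta> x)) * - \<delta> x) \<longlonglongrightarrow> K (- \<psi> x) * - \<delta> x"
      proof (intro AE_I2 tendsto_mult tendsto_const)
        fix x
        have lim: "(\<lambda>n. - (\<psi> x + inverse (real (Suc n)) * \<delta> x)) \<longlonglongrightarrow> - (\<psi> x + 0 * \<delta> x)"
          by (intro tendsto_intros LIMSEQ_inverse_real_of_nat)
        have "isCont K (- (\<psi> x + 0 * \<delta> x))" using K_cont by (simp add: continuous_on_eq_continuous_at)
        from isCont_tendsto_compose[OF this lim]
        show "(\<lambda>n. K (- (\<psi> x + inverse (real (Suc n)) * \<delta> x))) \<longlonglongrightarrow> K (- \<psi> x)" by simp
      qed
      show "AE x in lam. norm (K (- (\<psi> x + inverse (real (Suc n)) * \<delta> x)) * - \<delta> x) \<le> K (b + d) * d" for n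
        using pt by auto
    qed simp
  qed
  then have "?D \<le> (\<integral>x. K (- \<psi> x) * - \<delta> x \<partial>lam)"
  proof (rule LIMSEQ_le_const, intro exI[of _ 0] allI impI)
    show "?D \<le> (\<integral>x. K (- (\<psi> x + inverse (real (Suc n)) * \<delta> x)) * - \<delta> x \<partial>lam)" for n
      by (rule step) (auto simp: inverse_le_1_iff)
  qed
  also have "\<dots> = (\<integral>x. \<psi> x * K (- \<psi> x) - \<xi> x * K (- \<psi> x) \<partial>lam)"
    by (rule Bochner_Integration.integral_cong) (auto simp: \<delta>_def algebra_simps)
  also have "\<dots> = (\<integral>x. \<psi> x * K (- \<psi> x) \<partial>lam) - (\<integral>x. \<xi> x * K (- \<psi> x) \<partial>lam)"
    by (intro Bochner_Integration.integral_diff lam_integrable bborel_mult bborel_K psi xi)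
  finally show ?thesis by simp
qed

text \<open>Adding a constant \<open>a\<close> to \<psi> lowers the transform by \<open>a\<close>,
  so the first-order condition bounds \<open>a\<close> times the mass by \<open>a\<close>; the signs
  \<open>1\<close> and \<open>-1\<close> give equality.\<close>

lemma mass_one:
  assumes psi: "\<psi> \<in> bborel" and max: "\<And>\<xi>. \<xi> \<in> bborel \<Longrightarrow> J \<xi> \<le> J \<psi>"
  shows "(\<integral>x. K (- \<psi> x) \<partial>lam) = 1"
proof -
  have *: "a * (\<integral>x. K (- \<psi> x) \<partial>lam) \<le> a" for a
  proof -
    define \<xi> where "\<xi> x = \<psi> x + a" for x
    have xi: "\<xi> \<in> bborel" unfolding \<xi>_def by (intro bborel_add psi bborel_const)
    have "(\<integral>y. ct \<psi> y - a \<partial>\<nu>) \<le> (\<integral>y. ct \<xi> y \<partial>\<nu>)"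
    proof (rule integral_mono)
      show "ct \<psi> y - a \<le> ct \<xi> y" for y
        using ct_compare[OF bborel_bdd[OF psi], of \<xi> y y a] by (simp add: \<xi>_def)
    qed (intro nu_integrable bborel_diff bborel_ct psi xi bborel_const)+
    then have "(\<integral>y. ct \<psi> y \<partial>\<nu>) - a \<le> (\<integral>y. ct \<xi> y \<partial>\<nu>)"
      using nu_integrable[OF bborel_ct[OF psi]] by (simp add: nu.prob_space)
    moreover have "(\<integral>x. \<xi> x * K (- \<psi> x) \<partial>lam) = (\<integral>x. \<psi> x * K (- \<psi> x) \<partial>lam) + a * (\<integral>x. K (- \<psi> x) \<partial>lam)"
      using lam_integrable[OF bborel_mult[OF psi bborel_K[OF psi]]] lam_integrable[OF bborel_K[OF psi]]
      by (simp add: \<xi>_def distrib_right)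
    ultimately show ?thesis using J_first_order[OF psi max xi] by simp
  qed
  from *[of 1] *[of "-1"] show ?thesis by simp
qed

section \<open>Existence, uniqueness and the optimality condition\<close>

lemma plan_marginals:
  assumes "\<gamma> \<in> plans \<mu>' \<nu>"
  shows "prob_space \<gamma>" "sets \<gamma> = sets (borel \<Otimes>\<^sub>M borel)"
    "fst \<in> \<gamma> \<rightarrow>\<^sub>M borel" "snd \<in> \<gamma> \<rightarrow>\<^sub>M borel" "distr \<gamma> borel fst = \<mu>'" "distr \<gamma> borel snd = \<nu>"
    "integrable \<gamma> (case_prod c)"
proof -
  show g: "prob_space \<gamma>" "sets \<gamma> = sets (borel \<Otimes>\<^sub>M borel)" "distr \<gamma> borel fst = \<mu>'" "distr \<gamma> borel snd = \<nu>"
    using assms by (auto simp: plans_def)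
  show "fst \<in> \<gamma> \<rightarrow>\<^sub>M borel" "snd \<in> \<gamma> \<rightarrow>\<^sub>M borel"
    using measurable_cong_sets[OF g(2) refl, of borel] by auto
  interpret prob_space \<gamma> by fact
  show "integrable \<gamma> (case_prod c)"
    using c_measurable measurable_cong_sets[OF g(2) refl, of borel]
    by (intro integrable_const_bound[of _ R]) (auto simp: c_nonneg c_le)
qed

lemma plan_AE:
  assumes plan: "\<gamma> \<in> plans \<mu>' \<nu>" and mu': "\<mu>' \<in> probs \<Omega>"
  shows "AE z in \<gamma>. fst z \<in> \<Omega> \<and> snd z \<in> \<Omega>"
proof -
  note g = plan_marginals[OF plan]
  have "AE z in \<gamma>. fst z \<in> \<Omega>"
    using probs_AE[OF mu'] AE_distr_iff[OF g(3), of "\<lambda>x. x \<in> \<Omega>"] unfolding g(5) by simp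
  moreover have "AE z in \<gamma>. snd z \<in> \<Omega>"
    using probs_AE[OF nu] AE_distr_iff[OF g(4), of "\<lambda>x. x \<in> \<Omega>"] unfolding g(6) by simp
  ultimately show ?thesis by eventually_elim simp
qed

lemma plan_cost:
  assumes plan: "\<gamma> \<in> plans \<mu>' \<nu>" and mu': "\<mu>' \<in> probs \<Omega>"
  shows "(\<integral>\<^sup>+z. ennreal (dist (fst z) (snd z) powr p) \<partial>\<gamma>) = ennreal (\<integral>z. case_prod c z \<partial>\<gamma>)"
proof -
  have "(\<integral>\<^sup>+z. ennreal (dist (fst z) (snd z) powr p) \<partial>\<gamma>) = (\<integral>\<^sup>+z. ennreal (case_prod c z) \<partial>\<gamma>)"
  proof (rule nn_integral_cong_AE)
    show "AE z in \<gamma>. ennreal (dist (fst z) (snd z) powr p) = ennreal (case_prod c z)"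
      using plan_AE[OF assms] by eventually_elim (simp add: case_prod_beta' c_eq)
  qed
  also have "\<dots> = ennreal (\<integral>z. case_prod c z \<partial>\<gamma>)"
    by (intro nn_integral_eq_integral plan_marginals(7)[OF plan]) (auto simp: c_nonneg)
  finally show ?thesis .
qed

lemma Tp_ge:
  assumes mu': "\<mu>' \<in> probs \<Omega>" and psi: "\<psi> \<in> bborel"
  shows "ennreal ((\<integral>x. \<psi> x \<partial>\<mu>') + (\<integral>y. ct \<psi> y \<partial>\<nu>)) \<le> Tp p \<mu>' \<nu>"
  unfolding Tp_def
proof (rule INF_greatest)
  fix \<gamma> assume plan: "\<gamma> \<in> plans \<mu>' \<nu>"
  note g = plan_marginals[OF plan]
  note b = bborel_measurable[OF psi] bborel_measurable[OF bborel_ct[OF psi]]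
  have i1: "integrable \<gamma> (\<lambda>z. \<psi> (fst z))" "(\<integral>z. \<psi> (fst z) \<partial>\<gamma>) = (\<integral>x. \<psi> x \<partial>\<mu>')"
    using integrable_distr_eq[OF g(3) b(1)] integral_distr[OF g(3) b(1)] prob_integrable[OF mu' psi] g(5) by auto
  have i2: "integrable \<gamma> (\<lambda>z. ct \<psi> (snd z))" "(\<integral>z. ct \<psi> (snd z) \<partial>\<gamma>) = (\<integral>x. ct \<psi> x \<partial>\<nu>)"
    using integrable_distr_eq[OF g(4) b(2)] integral_distr[OF g(4) b(2)] nu_integrable[OF bborel_ct[OF psi]] g(6) by auto
  have "(\<integral>x. \<psi> x \<partial>\<mu>') + (\<integral>y. ct \<psi> y \<partial>\<nu>) = (\<integral>z. \<psi> (fst z) + ct \<psi> (snd z) \<partial>\<gamma>)"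
    using i1 i2 by simp
  also have "\<dots> \<le> (\<integral>z. case_prod c z \<partial>\<gamma>)"
  proof (intro integral_mono_AE g(7))
    show "AE z in \<gamma>. \<psi> (fst z) + ct \<psi> (snd z) \<le> case_prod c z"
      using plan_AE[OF plan mu']
    proof eventually_elim
      case (elim z)
      then show ?case
        using ct_le[OF bborel_bdd[OF psi], of "fst z" "snd z"] by (simp add: case_prod_beta')
    qed
  qed (use i1 i2 in auto)
  finally show "ennreal ((\<integral>x. \<psi> x \<partial>\<mu>') + (\<integral>y. ct \<psi> y \<partial>\<nu>)) \<le> (\<integral>\<^sup>+z. ennreal (dist (fst z) (snd z) powr p) \<partial>\<gamma>)"
    unfolding plan_cost[OF plan mu'] by (rule ennreal_leI)
qed

text \<open>Near-optimal plans for every \<open>t > 0\<close> are enough, as \<open>Tp\<close> is an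
  infimum. \<open>0 \<le> A\<close> is recorded so that sums under \<open>ennreal\<close> can be
  merged later.\<close>

lemma Tp_le:
  assumes mu: "\<mu> \<in> probs \<Omega>"
    and dual: "\<And>\<phi>. \<phi> \<in> bborel \<Longrightarrow> (\<integral>x. \<phi> x \<partial>\<mu>) + (\<integral>y. ct \<phi> y \<partial>\<nu>) \<le> A"
  shows "0 \<le> A" "Tp p \<mu> \<nu> \<le> ennreal A"
proof -
  have *: "\<exists>\<gamma>\<in>plans \<mu> \<nu>. (\<integral>z. case_prod c z \<partial>\<gamma>) \<le> A + t" if "0 < t" for t
    by (rule kantorovich_duality[OF mu nu dual that])
  show A: "0 \<le> A"
  proof (rule field_le_epsilon)
    fix t :: real assume "0 < t"
    then obtain \<gamma> where "(\<integral>z. case_prod c z \<partial>\<gamma>) \<le> A + t" using * by blast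
    moreover have "0 \<le> (\<integral>z. case_prod c z \<partial>\<gamma>)"
      by (rule Bochner_Integration.integral_nonneg) (auto simp: c_nonneg)
    ultimately show "0 \<le> A + t" by simp
  qed
  show "Tp p \<mu> \<nu> \<le> ennreal A"
  proof (rule ennreal_le_epsilon)
    fix t :: real assume t: "0 < t"
    then obtain \<gamma> where plan: "\<gamma> \<in> plans \<mu> \<nu>" and le: "(\<integral>z. case_prod c z \<partial>\<gamma>) \<le> A + t" using * by blast
    have "Tp p \<mu> \<nu> \<le> (\<integral>\<^sup>+z. ennreal (dist (fst z) (snd z) powr p) \<partial>\<gamma>)"
      unfolding Tp_def by (rule INF_lower[OF plan])
    also have "\<dots> \<le> ennreal (A + t)" unfolding plan_cost[OF plan mu] by (rule ennreal_leI[OF le])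
    also have "\<dots> = ennreal A + ennreal t" using A t by (simp add: ennreal_plus)
    finally show "Tp p \<mu> \<nu> \<le> ennreal A + ennreal t" .
  qed
qed

section \<open>Densities and the Young deficit\<close>

lemma integral_lam: "g \<in> borel_measurable borel \<Longrightarrow> (\<integral>x. g x \<partial>lam) = (\<integral>x. indicator \<Omega> x * g x \<partial>lborel :: real)"
  unfolding lam_def by (subst integral_density) auto

lemma nn_integral_lam: "(g :: 'a \<Rightarrow> ennreal) \<in> borel_measurable borel \<Longrightarrow> (\<integral>\<^sup>+x. g x \<partial>lam) = (\<integral>\<^sup>+x\<in>\<Omega>. g x \<partial>lborel)"
  unfolding lam_def by (subst nn_integral_density) (auto simp: ennreal_indicator mult.commute)

lemma density_facts:
  assumes mu': "\<mu>' \<in> probs \<Omega>" and v: "has_density \<mu>' v"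
  shows "AE x in lborel. x \<notin> \<Omega> \<longrightarrow> v x = 0"
    and "integrable lam v"
    and "\<psi> \<in> bborel \<Longrightarrow> (\<integral>x. \<psi> x \<partial>\<mu>') = (\<integral>x. \<psi> x * v x \<partial>lam)"
    and "\<psi> \<in> bborel \<Longrightarrow> integrable lam (\<lambda>x. \<psi> x * v x)"
proof -
  interpret M: prob_space \<mu>' using mu' by (simp add: probs_def)
  have vm [measurable]: "v \<in> borel_measurable borel" and v0: "\<And>x. 0 \<le> v x"
    and eq: "\<mu>' = density lborel (\<lambda>x. ennreal (v x))" using v by (auto simp: has_density_def)
  have "(\<integral>\<^sup>+x. ennreal (v x) * indicator (UNIV - \<Omega>) x \<partial>lborel) = emeasure \<mu>' (UNIV - \<Omega>)"
    unfolding eq by (subst emeasure_density) auto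
  also have "\<dots> = 0" using mu' by (simp add: probs_def)
  finally have "AE x in lborel. ennreal (v x) * indicator (UNIV - \<Omega>) x = 0"
    by (subst (asm) nn_integral_0_iff_AE) auto
  then show ae: "AE x in lborel. x \<notin> \<Omega> \<longrightarrow> v x = 0"
    by eventually_elim (use v0 in \<open>auto simp: indicator_def antisym\<close>)
  show int: "integrable lam v"
  proof (rule integrableI_nonneg)
    have "(\<integral>\<^sup>+x. ennreal (v x) \<partial>lam) \<le> (\<integral>\<^sup>+x. ennreal (v x) \<partial>lborel)"
      by (subst nn_integral_lam) (auto intro!: nn_integral_mono simp: indicator_def)
    also have "\<dots> = emeasure \<mu>' (space \<mu>')" unfolding eq by (subst emeasure_density) auto
    also have "\<dots> = 1" by (rule M.emeasure_space_1)
    finally show "(\<integral>\<^sup>+x. ennreal (v x) \<partial>lam) < \<infinity>" by (rule order.strict_trans1) simp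
  qed (use v0 in auto)
  show "integrable lam (\<lambda>x. \<psi> x * v x)" if psi: "\<psi> \<in> bborel"
  proof -
    obtain b where b: "\<And>x. \<bar>\<psi> x\<bar> \<le> b" using psi bborelE by blast
    note [measurable] = bborel_measurable[OF psi]
    show ?thesis
    proof (rule Bochner_Integration.integrable_bound[of lam "\<lambda>x. b * v x"])
      show "AE x in lam. norm (\<psi> x * v x) \<le> norm (b * v x)"
      proof (rule AE_I2)
        fix x
        have "\<bar>\<psi> x\<bar> * \<bar>v x\<bar> \<le> \<bar>b\<bar> * \<bar>v x\<bar>" using b[of x] by (intro mult_right_mono) auto
        then show "norm (\<psi> x * v x) \<le> norm (b * v x)" by (simp add: abs_mult)
      qed
    qed (use int in auto)
  qed
  show "(\<integral>x. \<psi> x \<partial>\<mu>') = (\<integral>x. \<psi> x * v x \<partial>lam)" if psi: "\<psi> \<in> bborel"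
  proof -
    note [measurable] = bborel_measurable[OF psi]
    have "(\<integral>x. \<psi> x \<partial>\<mu>') = (\<integral>x. v x * \<psi> x \<partial>lborel)"
      unfolding eq using v0 by (subst integral_density) auto
    also have "\<dots> = (\<integral>x. indicator \<Omega> x * (\<psi> x * v x) \<partial>lborel)"
    proof (rule integral_cong_AE)
      show "AE x in lborel. v x * \<psi> x = indicator \<Omega> x * (\<psi> x * v x)"
        using ae by eventually_elim (auto simp: indicator_def)
    qed auto
    also have "\<dots> = (\<integral>x. \<psi> x * v x \<partial>lam)" by (subst integral_lam) auto
    finally show ?thesis .
  qed
qed

text \<open>The \<open>fs\<close> integral of \<open>J\<close> is added and subtracted, and the
  \<mu>'-integral of \<psi> is written with the density; finiteness of the energy makes the
  splitting legitimate.\<close>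

lemma energy_gap:
  assumes mu': "\<mu>' \<in> probs \<Omega>" and v: "has_density \<mu>' v" and psi: "\<psi> \<in> bborel"
    and fin: "(\<integral>\<^sup>+x\<in>\<Omega>. ennreal (f (v x)) \<partial>lborel) < \<infinity>"
  defines "gap \<equiv> \<lambda>x. f (v x) + fs (- \<psi> x) + \<psi> x * v x"
  shows "(\<integral>\<^sup>+x\<in>\<Omega>. ennreal (f (v x)) \<partial>lborel) = ennreal (\<integral>x. f (v x) \<partial>lam)"
    and "integrable lam gap" and "\<And>x. 0 \<le> gap x"
    and "(\<integral>x. \<psi> x \<partial>\<mu>') + (\<integral>y. ct \<psi> y \<partial>\<nu>) + (\<integral>x. f (v x) \<partial>lam) = J \<psi> + (\<integral>x. gap x \<partial>lam)"
proof -
  have [measurable]: "v \<in> borel_measurable borel" and v0: "\<And>x. 0 \<le> v x" using v by (auto simp: has_density_def)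
  have fv [measurable]: "(\<lambda>x. f (v x)) \<in> borel_measurable borel" by (rule measurable_f_comp) (auto simp: v0)
  have eq: "(\<integral>\<^sup>+x. ennreal (f (v x)) \<partial>lam) = (\<integral>\<^sup>+x\<in>\<Omega>. ennreal (f (v x)) \<partial>lborel)"
    by (rule nn_integral_lam) measurable
  have int: "integrable lam (\<lambda>x. f (v x))"
    by (rule integrableI_nonneg) (use fin eq f_nonneg v0 in auto)
  show "(\<integral>\<^sup>+x\<in>\<Omega>. ennreal (f (v x)) \<partial>lborel) = ennreal (\<integral>x. f (v x) \<partial>lam)"
    unfolding eq[symmetric] using f_nonneg v0 by (intro nn_integral_eq_integral int) auto
  note i = int lam_integrable[OF bborel_fs[OF psi]] density_facts(4)[OF mu' v psi]
  show "integrable lam gap" unfolding gap_def using i by auto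
  show "0 \<le> gap x" for x unfolding gap_def using young[OF v0[of x], of "- \<psi> x"] by simp
  show "(\<integral>x. \<psi> x \<partial>\<mu>') + (\<integral>y. ct \<psi> y \<partial>\<nu>) + (\<integral>x. f (v x) \<partial>lam) = J \<psi> + (\<integral>x. gap x \<partial>lam)"
    unfolding gap_def J_def density_facts(3)[OF mu' v psi] using i by simp
qed

text \<open>\<open>Fent\<close> evaluates a density picked by \<open>SOME\<close>, so energies are
  computed for that representative and compared with others almost everywhere.\<close>

lemma Fent_some:
  assumes "has_density \<mu>' v"
  obtains w where "has_density \<mu>' w" "Fent f \<Omega> \<mu>' = (\<integral>\<^sup>+x\<in>\<Omega>. ennreal (f (w x)) \<partial>lborel)"
proof -
  have "has_density \<mu>' (SOME u. has_density \<mu>' u)" using assms by (rule someI[where P="has_density \<mu>'"])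
  then show ?thesis using assms by (intro that[of "SOME u. has_density \<mu>' u"]) (auto simp: Fent_def)
qed

lemma density_AE_unique:
  assumes "has_density \<mu>' v" "has_density \<mu>' w"
  shows "AE x in lborel. v x = w x"
proof -
  have "density lborel (\<lambda>x. ennreal (v x)) = density lborel (\<lambda>x. ennreal (w x))"
    using assms by (metis has_density_def)
  then have "AE x in lborel. ennreal (v x) = ennreal (w x)"
    using assms by (intro sigma_finite_measure.density_unique[OF sigma_finite_lborel]) (auto simp: has_density_def)
  then show ?thesis
    by eventually_elim (use assms in \<open>auto simp: has_density_def\<close>)
qed

section \<open>Back to transforms and Kantorovich values on the domain\<close>

lemma c_transform_eq: "y \<in> \<Omega> \<Longrightarrow> c_transform \<Omega> p \<phi> y = ct \<phi> y"
  unfolding c_transform_def ct_def by (intro INF_cong) (auto simp: c_eq)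

lemma set_integral_probs:
  assumes M: "M \<in> probs \<Omega>" and "\<phi> \<in> bborel" and eq: "\<And>x. x \<in> \<Omega> \<Longrightarrow> \<phi>' x = \<phi> x"
  shows "(LINT x:\<Omega>|M. \<phi>' x) = (\<integral>x. \<phi> x \<partial>M)"
proof -
  have "(LINT x:\<Omega>|M. \<phi>' x) = (\<integral>x. indicator \<Omega> x * \<phi> x \<partial>M)"
    unfolding set_lebesgue_integral_def
    by (rule Bochner_Integration.integral_cong) (auto simp: indicator_def eq)
  also have "\<dots> = (\<integral>x. \<phi> x \<partial>M)"
  proof (intro integral_cong_AE borel_measurable_integrable prob_integrable[OF M] bborel_mult
      bborel_indicator dom_borel assms(2))
    show "AE x in M. indicator \<Omega> x * \<phi> x = \<phi> x" using probs_AE[OF M] by eventually_elim simp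
  qed
  finally show ?thesis .
qed

text \<open>A c-concave function is prescribed on \<Omega> alone; any bounded Borel function
  agreeing with it there has the same value.\<close>

lemma kant_value_eq:
  assumes M: "M \<in> probs \<Omega>" and phi: "\<phi> \<in> bborel" and eq: "\<And>x. x \<in> \<Omega> \<Longrightarrow> \<phi>' x = \<phi> x"
  shows "kant_value \<Omega> p M \<nu> \<phi>' = (\<integral>x. \<phi> x \<partial>M) + (\<integral>y. ct \<phi> y \<partial>\<nu>)"
proof -
  have "ct \<phi>' = ct \<phi>" unfolding ct_def using eq by (intro ext INF_cong) auto
  then have "(LINT y:\<Omega>|\<nu>. c_transform \<Omega> p \<phi>' y) = (\<integral>y. ct \<phi> y \<partial>\<nu>)"
    by (intro set_integral_probs nu bborel_ct phi) (simp add: c_transform_eq)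
  then show ?thesis unfolding kant_value_def using set_integral_probs[OF M phi eq] by simp
qed

text \<open>Every finite energy is at least \<open>J \<psi>\<close> plus its integrated Young
  deficit, while \<mu> reaches \<open>J \<psi>\<close>. Another minimiser has deficit zero almost
  everywhere in \<Omega>, hence the same density.\<close>

lemma minimizer_characterization:
  "\<exists>\<mu> u \<psi>. (\<forall>\<mu>'. is_minimizer p f \<Omega> \<nu> \<mu>' \<longleftrightarrow> \<mu>' = \<mu>) \<and>
     has_density \<mu> u \<and> kantorovich_potential \<Omega> p \<mu> \<nu> \<psi> \<and>
     (\<forall>x\<in>\<Omega>. - \<psi> x \<ge> 0 \<and> u x = kinv fd (- \<psi> x))"
proof -
  obtain \<psi> g where g: "bdd_above (g ` \<Omega>)" "\<psi> = ct g" and psi: "\<psi> \<in> bborel"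
    and neg: "\<And>x. x \<in> \<Omega> \<Longrightarrow> \<psi> x \<le> 0" and max: "\<And>\<xi>. \<xi> \<in> bborel \<Longrightarrow> J \<xi> \<le> J \<psi>"
    using J_attained by blast
  \<comment> \<open>As a transform, \<psi> is also defined outside \<Omega>, where
    \<open>K (- \<psi> x)\<close> may be positive.\<close>
  define u where "u x = indicator \<Omega> x * K (- \<psi> x)" for x
  define \<mu> where "\<mu> = density lborel (\<lambda>x. ennreal (u x))"
  have Kb: "(\<lambda>x. K (- \<psi> x)) \<in> bborel" by (rule bborel_K[OF psi])
  have um [measurable]: "u \<in> borel_measurable borel"
    unfolding u_def by (intro bborel_measurable bborel_mult bborel_indicator Kb dom_borel)
  have u0: "0 \<le> u x" for x by (simp add: u_def K_nonneg)
  have dens: "has_density \<mu> u" by (simp add: has_density_def \<mu>_def u0)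
  have mu: "\<mu> \<in> probs \<Omega>"
  proof -
    have "emeasure \<mu> (space \<mu>) = (\<integral>\<^sup>+x. ennreal (u x) \<partial>lborel)"
      unfolding \<mu>_def by (subst emeasure_density) auto
    also have "\<dots> = (\<integral>\<^sup>+x\<in>\<Omega>. ennreal (K (- \<psi> x)) \<partial>lborel)"
      by (intro nn_integral_cong) (auto simp: u_def indicator_def)
    also have "\<dots> = (\<integral>\<^sup>+x. ennreal (K (- \<psi> x)) \<partial>lam)"
      using bborel_measurable[OF Kb]
      by (intro nn_integral_lam[symmetric] measurable_compose[OF _ measurable_ennreal])
    also have "\<dots> = 1"
      using mass_one[OF psi max] nn_integral_eq_integral[OF lam_integrable[OF Kb]] K_nonneg by simp
    finally have "prob_space \<mu>" by (rule prob_spaceI)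
    moreover have "emeasure \<mu> (UNIV - \<Omega>) = 0"
    proof -
      have "emeasure \<mu> (UNIV - \<Omega>) = (\<integral>\<^sup>+x\<in>UNIV - \<Omega>. ennreal (u x) \<partial>lborel)"
        unfolding \<mu>_def by (rule emeasure_density) auto
      also have "\<dots> = (\<integral>\<^sup>+x. 0 \<partial>(lborel :: 'a measure))"
        by (rule nn_integral_cong) (auto simp: u_def indicator_def)
      finally show ?thesis by simp
    qed
    ultimately show ?thesis by (simp add: probs_def \<mu>_def)
  qed
  have int_mu: "(\<integral>x. \<phi> x \<partial>\<mu>) = (\<integral>x. \<phi> x * K (- \<psi> x) \<partial>lam)" if phi: "\<phi> \<in> bborel" for \<phi>
  proof -
    have "(\<integral>x. \<phi> x \<partial>\<mu>) = (\<integral>x. \<phi> x * u x \<partial>lam)" by (rule density_facts(3)[OF mu dens phi])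
    also have "\<dots> = (\<integral>x. \<phi> x * K (- \<psi> x) \<partial>lam)"
    proof (rule integral_cong_AE)
      show "AE x in lam. \<phi> x * u x = \<phi> x * K (- \<psi> x)"
        using AE_lam_dom by eventually_elim (simp add: u_def)
      show "(\<lambda>x. \<phi> x * u x) \<in> borel_measurable lam" using bborel_measurable[OF phi] by auto
      show "(\<lambda>x. \<phi> x * K (- \<psi> x)) \<in> borel_measurable lam"
        by (intro borel_measurable_integrable lam_integrable bborel_mult phi Kb)
    qed
    finally show ?thesis .
  qed
  define A where "A = (\<integral>x. \<psi> x \<partial>\<mu>) + (\<integral>y. ct \<psi> y \<partial>\<nu>)"
  have dual: "(\<integral>x. \<phi> x \<partial>\<mu>) + (\<integral>y. ct \<phi> y \<partial>\<nu>) \<le> A" if "\<phi> \<in> bborel" for \<phi>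
    unfolding A_def int_mu[OF that] int_mu[OF psi] by (rule J_first_order[OF psi max that])
  have A: "0 \<le> A" "Tp p \<mu> \<nu> \<le> ennreal A" using Tp_le[OF mu dual] by blast+
  \<comment> \<open>The deficit is kept in the bound: its sign gives minimality, its vanishing gives
    uniqueness.\<close>
  have lower: "frakF p f \<Omega> \<nu> \<mu>' = \<infinity> \<or> (\<exists>w. has_density \<mu>' w \<and> integrable lam (\<lambda>x. f (w x) + fs (- \<psi> x) + \<psi> x * w x) \<and>
      (\<forall>x. 0 \<le> f (w x) + fs (- \<psi> x) + \<psi> x * w x) \<and>
      ennreal (J \<psi> + (\<integral>x. f (w x) + fs (- \<psi> x) + \<psi> x * w x \<partial>lam)) \<le> frakF p f \<Omega> \<nu> \<mu>')"
    if mu': "\<mu>' \<in> probs \<Omega>" for \<mu>'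
  proof (cases "(\<exists>v. has_density \<mu>' v) \<and> Fent f \<Omega> \<mu>' \<noteq> \<infinity>")
    case False
    then have "Fent f \<Omega> \<mu>' = \<infinity>" unfolding Fent_def by meson
    then show ?thesis by (simp add: frakF_def)
  next
    case True
    then obtain v where "has_density \<mu>' v" by blast
    then obtain w where w: "has_density \<mu>' w" "Fent f \<Omega> \<mu>' = (\<integral>\<^sup>+x\<in>\<Omega>. ennreal (f (w x)) \<partial>lborel)"
      using Fent_some by blast
    have fin: "(\<integral>\<^sup>+x\<in>\<Omega>. ennreal (f (w x)) \<partial>lborel) < \<infinity>" using True w(2) by (simp add: less_top)
    note G = energy_gap[OF mu' w(1) psi fin]
    have "0 \<le> (\<integral>x. f (w x) \<partial>lam)"
      using w(1) f_nonneg by (intro Bochner_Integration.integral_nonneg) (auto simp: has_density_def)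
    then have "ennreal ((\<integral>x. \<psi> x \<partial>\<mu>') + (\<integral>y. ct \<psi> y \<partial>\<nu>) + (\<integral>x. f (w x) \<partial>lam))
        \<le> ennreal ((\<integral>x. \<psi> x \<partial>\<mu>') + (\<integral>y. ct \<psi> y \<partial>\<nu>)) + ennreal (\<integral>x. f (w x) \<partial>lam)"
      by (rule ennreal_add_le_add)
    also have "\<dots> \<le> frakF p f \<Omega> \<nu> \<mu>'"
      unfolding frakF_def w(2) G(1) by (intro add_mono Tp_ge mu' psi order_refl)
    finally show ?thesis using w(1) G(2-4) by auto
  qed
  obtain w where w: "has_density \<mu> w" "Fent f \<Omega> \<mu> = (\<integral>\<^sup>+x\<in>\<Omega>. ennreal (f (w x)) \<partial>lborel)"
    using Fent_some[OF dens] by blast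
  have wK: "AE x in lam. w x = K (- \<psi> x)"
    unfolding AE_lam using density_AE_unique[OF w(1) dens] by eventually_elim (simp add: u_def)
  have wm [measurable]: "w \<in> borel_measurable borel" and w0: "\<And>x. 0 \<le> w x" using w(1) by (auto simp: has_density_def)
  have upper: "frakF p f \<Omega> \<nu> \<mu> \<le> ennreal (J \<psi>)" and J0: "0 \<le> J \<psi>"
  proof -
    \<comment> \<open>\<open>energy_gap\<close> presupposes finite energy; equality in Young's
      inequality and \<open>fs \<ge> 0\<close> bound the energy density by a bounded
      function.\<close>
    have fK: "f (K (- \<psi> x)) \<le> K (- \<psi> x) * - \<psi> x" for x
      using young_eq[of "- \<psi> x"] fs_nonneg[of "- \<psi> x"] by (simp add: mult.commute)
    have fm: "(\<lambda>x. ennreal (f (w x))) \<in> borel_measurable borel"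
      using measurable_f_comp[OF wm w0] by measurable
    have "(\<integral>\<^sup>+x\<in>\<Omega>. ennreal (f (w x)) \<partial>lborel) = (\<integral>\<^sup>+x. ennreal (f (w x)) \<partial>lam)"
      by (rule nn_integral_lam[OF fm, symmetric])
    also have "\<dots> \<le> (\<integral>\<^sup>+x. ennreal (K (- \<psi> x) * \<bar>\<psi> x\<bar>) \<partial>lam)"
    proof (rule nn_integral_mono_AE)
      show "AE x in lam. ennreal (f (w x)) \<le> ennreal (K (- \<psi> x) * \<bar>\<psi> x\<bar>)"
        using wK
      proof eventually_elim
        case (elim x)
        have "K (- \<psi> x) * - \<psi> x \<le> K (- \<psi> x) * \<bar>\<psi> x\<bar>" using K_nonneg by (intro mult_left_mono) auto
        then show ?case using fK[of x] by (auto simp: elim intro!: ennreal_leI)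
      qed
    qed
    also have "\<dots> < \<infinity>"
      using nn_integral_eq_integral[OF lam_integrable[OF bborel_mult[OF Kb bborel_comp[OF psi, of abs]]]] K_nonneg
      by (simp add: continuous_on_rabs[OF continuous_on_id])
    finally have fin: "(\<integral>\<^sup>+x\<in>\<Omega>. ennreal (f (w x)) \<partial>lborel) < \<infinity>" .
    note G = energy_gap[OF mu w(1) psi fin]
    have "(\<integral>x. f (w x) + fs (- \<psi> x) + \<psi> x * w x \<partial>lam) = (\<integral>x. 0 \<partial>lam)"
    proof (rule integral_cong_AE)
      show "AE x in lam. f (w x) + fs (- \<psi> x) + \<psi> x * w x = 0"
        using wK
      proof eventually_elim
        case (elim x)
        then show ?case using young_eq[of "- \<psi> x"] by simp
      qed
      show "(\<lambda>x. f (w x) + fs (- \<psi> x) + \<psi> x * w x) \<in> borel_measurable lam"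
        using G(2) by (rule borel_measurable_integrable)
    qed simp
    then have eq: "A + (\<integral>x. f (w x) \<partial>lam) = J \<psi>" using G(4) by (simp add: A_def)
    have F0: "0 \<le> (\<integral>x. f (w x) \<partial>lam)"
      using w0 f_nonneg by (intro Bochner_Integration.integral_nonneg) auto
    have "frakF p f \<Omega> \<nu> \<mu> \<le> ennreal A + ennreal (\<integral>x. f (w x) \<partial>lam)"
      unfolding frakF_def w(2) G(1) by (intro add_mono A order_refl)
    also have "\<dots> = ennreal (J \<psi>)" using A(1) F0 by (simp add: eq flip: ennreal_plus)
    finally show "frakF p f \<Omega> \<nu> \<mu> \<le> ennreal (J \<psi>)" .
    show "0 \<le> J \<psi>" using eq A(1) F0 by simp
  qed
  have "is_minimizer p f \<Omega> \<nu> \<mu>"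
    unfolding is_minimizer_def
  proof (intro conjI mu ballI)
    fix \<mu>' assume "\<mu>' \<in> probs \<Omega>"
    from lower[OF this] show "frakF p f \<Omega> \<nu> \<mu> \<le> frakF p f \<Omega> \<nu> \<mu>'"
    proof (elim disjE exE conjE)
      fix w assume 0: "\<forall>x. 0 \<le> f (w x) + fs (- \<psi> x) + \<psi> x * w x"
        and le: "ennreal (J \<psi> + (\<integral>x. f (w x) + fs (- \<psi> x) + \<psi> x * w x \<partial>lam)) \<le> frakF p f \<Omega> \<nu> \<mu>'"
      have "0 \<le> (\<integral>x. f (w x) + fs (- \<psi> x) + \<psi> x * w x \<partial>lam)"
        using 0 by (intro Bochner_Integration.integral_nonneg) auto
      then have "ennreal (J \<psi>) \<le> ennreal (J \<psi> + (\<integral>x. f (w x) + fs (- \<psi> x) + \<psi> x * w x \<partial>lam))"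
        by (intro ennreal_leI) simp
      then show ?thesis using upper le by (meson order_trans)
    qed simp
  qed
  moreover have "\<mu>' = \<mu>" if min: "is_minimizer p f \<Omega> \<nu> \<mu>'" for \<mu>'
  proof -
    have mu': "\<mu>' \<in> probs \<Omega>" using min by (simp add: is_minimizer_def)
    have le: "frakF p f \<Omega> \<nu> \<mu>' \<le> ennreal (J \<psi>)"
      using min mu upper unfolding is_minimizer_def by (meson order_trans)
    then have "frakF p f \<Omega> \<nu> \<mu>' \<noteq> \<infinity>" by (auto simp: top_unique)
    then obtain v where v: "has_density \<mu>' v"
      and int: "integrable lam (\<lambda>x. f (v x) + fs (- \<psi> x) + \<psi> x * v x)"
      and pos: "\<And>x. 0 \<le> f (v x) + fs (- \<psi> x) + \<psi> x * v x"
      and ge: "ennreal (J \<psi> + (\<integral>x. f (v x) + fs (- \<psi> x) + \<psi> x * v x \<partial>lam)) \<le> frakF p f \<Omega> \<nu> \<mu>'"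
      using lower[OF mu'] by blast
    let ?gap = "\<lambda>x. f (v x) + fs (- \<psi> x) + \<psi> x * v x"
    have v0: "\<And>x. 0 \<le> v x" and [measurable]: "v \<in> borel_measurable borel" using v by (auto simp: has_density_def)
    \<comment> \<open>Nonnegativity of \<open>J \<psi>\<close> allows the \<open>ennreal\<close>
      inequality to be read back in the reals.\<close>
    have "J \<psi> + (\<integral>x. ?gap x \<partial>lam) \<le> J \<psi>" using order_trans[OF ge le] J0 by simp
    moreover have "0 \<le> (\<integral>x. ?gap x \<partial>lam)" using pos by (intro Bochner_Integration.integral_nonneg) auto
    ultimately have "(\<integral>x. ?gap x \<partial>lam) = 0" by simp
    then have "AE x in lam. ?gap x = 0"
      using integral_nonneg_eq_0_iff_AE[OF int] pos by auto
    then have "AE x in lam. v x = K (- \<psi> x)"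
    proof eventually_elim
      case (elim x)
      then show ?case using young_strict[OF v0[of x], of "- \<psi> x"] by (cases "v x = K (- \<psi> x)") auto
    qed
    then have "AE x in lborel. x \<in> \<Omega> \<longrightarrow> v x = K (- \<psi> x)" by (simp add: AE_lam)
    then have "AE x in lborel. v x = u x"
      using density_facts(1)[OF mu' v] by eventually_elim (auto simp: u_def indicator_def)
    then have "density lborel (\<lambda>x. ennreal (v x)) = density lborel (\<lambda>x. ennreal (u x))"
      by (intro density_cong) (auto elim!: eventually_mono)
    then show ?thesis using v by (simp add: has_density_def \<mu>_def)
  qed
  moreover have "kantorovich_potential \<Omega> p \<mu> \<nu> \<psi>"
    unfolding kantorovich_potential_def
  proof (intro conjI allI impI)
    show "c_concave \<Omega> p \<psi>" unfolding c_concave_def using g by (auto simp: c_transform_eq)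
    fix \<phi> assume "c_concave \<Omega> p \<phi>"
    then obtain \<xi> where xi: "bdd_above (\<xi> ` \<Omega>)" and eq: "\<And>y. y \<in> \<Omega> \<Longrightarrow> \<phi> y = ct \<xi> y"
      unfolding c_concave_def by (auto simp: c_transform_eq)
    \<comment> \<open>The competitor agrees on \<Omega> with this transform, which is bounded Borel
      and hence admissible in \<open>dual\<close>.\<close>
    have b: "ct \<xi> \<in> bborel" by (rule ct_bborel[OF xi])
    show "kant_value \<Omega> p \<mu> \<nu> \<phi> \<le> kant_value \<Omega> p \<mu> \<nu> \<psi>"
      using dual[OF b] kant_value_eq[OF mu b eq] kant_value_eq[OF mu psi refl] by (simp add: A_def)
  qed
  moreover have "\<forall>x\<in>\<Omega>. - \<psi> x \<ge> 0 \<and> u x = kinv fd (- \<psi> x)"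
    using neg by (auto simp: u_def K_eq)
  ultimately show ?thesis using dens by blast
qed

end

section \<open>The truncated power cost\<close>

lemma powr_lipschitz:
  fixes a b D p :: real
  assumes "1 \<le> p" "0 \<le> a" "a \<le> b" "b \<le> D"
  shows "b powr p - a powr p \<le> p * D powr (p - 1) * (b - a)"
proof (cases "a = b")
  case False
  then have ab: "a < b" using assms by simp
  have "continuous_on {a..b} (\<lambda>x. x powr p)"
    using assms by (intro continuous_on_powr' continuous_intros) auto
  \<comment> \<open>Points of the open interval are positive even when \<open>a = 0\<close>, so the
    derivative formula applies.\<close>
  moreover have "((\<lambda>x. x powr p) has_derivative (\<lambda>h. p * x powr (p - 1) * h)) (at x)" if "a < x" "x < b" for x
    using that assms has_real_derivative_powr[of x p] by (auto simp: has_field_derivative_def)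
  ultimately obtain x where x: "a < x" "x < b" "b powr p - a powr p = p * x powr (p - 1) * (b - a)"
    using mvt[OF ab, of "\<lambda>x. x powr p" "\<lambda>x h. p * x powr (p - 1) * h"] by auto
  have "p * x powr (p - 1) * (b - a) \<le> p * D powr (p - 1) * (b - a)"
    using x assms by (intro mult_right_mono mult_left_mono powr_mono2) auto
  then show ?thesis using x(3) by simp
qed simp

text \<open>Truncating at the diameter makes the cost bounded and Lipschitz on the whole space
  without changing it on \<open>\<Omega>\<close>.\<close>

lemma truncated_cost:
  fixes \<Omega> :: "'a::euclidean_space set"
  assumes "1 \<le> p" "0 \<le> D" "compact \<Omega>" "\<Omega> \<noteq> {}"
  shows "lipschitz_cost \<Omega> (\<lambda>x y. min (dist x y) D powr p) (p * D powr (p - 1)) (D powr p)"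
proof
  fix x y x' :: 'a
  show "min (dist x y) D powr p \<le> D powr p" using assms by (intro powr_mono2) auto
  define a b where "a = min (dist x y) D" and "b = min (dist x' y) D"
  have *: "s powr p - r powr p \<le> p * D powr (p - 1) * \<bar>r - s\<bar>" if "0 \<le> r" "0 \<le> s" "s \<le> D" for r s
  proof (cases "r \<le> s")
    case True
    then show ?thesis using powr_lipschitz[of p r s D] that assms by simp
  next
    case False
    then have "s powr p \<le> r powr p" using that assms by (intro powr_mono2) auto
    moreover have "0 \<le> p * D powr (p - 1) * \<bar>r - s\<bar>" using assms by simp
    ultimately show ?thesis by linarith
  qed
  have ab: "0 \<le> a" "0 \<le> b" "a \<le> D" "b \<le> D" using assms by (auto simp: a_def b_def)
  have "\<bar>a - b\<bar> \<le> dist x x'"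
    using dist_triangle[of x y x'] dist_triangle[of x' y x] by (simp add: a_def b_def dist_commute)
  then have "p * D powr (p - 1) * \<bar>a - b\<bar> \<le> p * D powr (p - 1) * dist x x'"
    using assms by (intro mult_left_mono) auto
  then show "\<bar>min (dist x y) D powr p - min (dist x' y) D powr p\<bar> \<le> p * D powr (p - 1) * dist x x'"
    using *[of a b] *[of b a] ab unfolding a_def[symmetric] b_def[symmetric]
    by (simp add: abs_le_iff abs_minus_commute)
qed (use assms in \<open>auto simp: dist_commute\<close>)

theorem theorem3p8:
  fixes \<Omega> :: "'a::euclidean_space set" and f fd :: "real \<Rightarrow> real"
    and p :: real and \<nu> :: "'a measure"
  assumes "bounded_domain \<Omega>"
    and "standing_f f fd"
    and "p \<ge> 1"
    and "\<nu> \<in> probs \<Omega>"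
  shows "(\<exists>!\<mu>. is_minimizer p f \<Omega> \<nu> \<mu>) \<and>
         (\<forall>\<mu>. is_minimizer p f \<Omega> \<nu> \<mu> \<longrightarrow>
           (\<exists>u \<psi>. has_density \<mu> u \<and> kantorovich_potential \<Omega> p \<mu> \<nu> \<psi> \<and>
              (AE x in lborel. x \<in> \<Omega> \<longrightarrow> - \<psi> x \<ge> 0 \<and> u x = kinv fd (- \<psi> x))))"
proof -
  obtain U where U: "open U" "U \<noteq> {}" "\<Omega> = closure U" and bdd: "bounded \<Omega>"
    using assms(1) by (auto simp: bounded_domain_def)
  have comp: "compact \<Omega>" using U bdd by (simp add: compact_eq_bounded_closed)
  have ne: "\<Omega> \<noteq> {}" using U by simp
  have vol: "0 < measure lborel \<Omega>"
  proof -
    have "U \<notin> null_sets lborel" using U(1,2) open_not_negligible[of U] negligible_iff_null_sets null_sets_completionI by blast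
    then have "\<Omega> \<notin> null_sets lborel" using U closure_subset null_sets_subset[of \<Omega> lborel U] by auto
    then show ?thesis
      using comp emeasure_compact_finite[OF comp]
      by (auto simp: null_sets_def zero_less_measure_iff measure_def enn2real_positive_iff compact_imp_closed zero_less_iff_neq_zero)
  qed
  define D where "D = diameter \<Omega>"
  have D: "0 \<le> D" "\<And>x y. x \<in> \<Omega> \<Longrightarrow> y \<in> \<Omega> \<Longrightarrow> dist x y \<le> D"
    using bdd diameter_ge_0 diameter_bounded_bound by (auto simp: D_def)
  interpret lipschitz_cost \<Omega> "\<lambda>x y. min (dist x y) D powr p" "p * D powr (p - 1)" "D powr p"
    by (rule truncated_cost[OF assms(3) D(1) comp ne])
  interpret energy_problem \<Omega> "\<lambda>x y. min (dist x y) D powr p" "p * D powr (p - 1)" "D powr p" f fd p \<nu>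
    by unfold_locales (use assms vol D(2) in \<open>auto simp: min_def\<close>)
  obtain \<mu> u \<psi> where min: "\<And>\<mu>'. is_minimizer p f \<Omega> \<nu> \<mu>' \<longleftrightarrow> \<mu>' = \<mu>"
    and "has_density \<mu> u" "kantorovich_potential \<Omega> p \<mu> \<nu> \<psi>"
    and "\<forall>x\<in>\<Omega>. - \<psi> x \<ge> 0 \<and> u x = kinv fd (- \<psi> x)"
    using minimizer_characterization by metis
  then show ?thesis unfolding min by auto
qed

end
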